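(* Let $(X,\sigma)$ be a classical symbolic system (a two-sided subshift $X\subset\Lambda^{\mathbb Z}$ or a one-sided subshift $X\subset\Lambda^{\mathbb N_0}$ over a finite alphabet $\Lambda$). Let $\mathcal U$ be an open set in $\mathcal B^*(X)\cup\mathcal M(X)$ (with the metric $d^*$) such that $\mathcal U\supset\mathcal M^{\mathsf{erg}}_\sigma(X)$. For every $m\in\mathbb N$ and every $\varepsilon>0$ there exists $n\ge m$ such that for every $x\in X$ there exists a representation of $x$ as an infinite concatenation of finite blocks $x=\dots B_{-2}A_{-2}B_{-1}A_{-1}A_1B_1A_2B_2\dots$ (respectively $x=A_1B_1A_2B_2\dots$ in the case of a one-sided subshift), where all blocks $B_j$ are $\mathcal U$-ergodic (i.e. $B_j\in\mathcal U$) and have lengths ranging between $m$ and $n$, and the set $M^{\mathsf{NE}}(x)$ of coordinates pertaining to the blocks $A_j$ in this concatenation has upper Banach density smaller than $\varepsilon$. (Some of the blocks $A_j$ may be empty, i.e. have length zero.)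
   Context: $\Lambda$ is a finite discrete set. The shift is $(\sigma(x))(i)=x(i+1)$. A two-sided (one-sided) subshift is a closed subset $X$ of $\Lambda^{\mathbb Z}$ (resp. $\Lambda^{\mathbb N_0}$) invariant under $\sigma$ (i.e. $\sigma(X)=X$ in the two-sided case, $\sigma(X)\subset X$ in the one-sided case). Coordinates $i$ range over $\mathbb Z$ (resp. $\mathbb N_0$). A block of length $k$ is an element $B\in\Lambda^k$, $|B|=k$. $\mathcal B^*(X)$ is the set of all blocks occurring in elements of $X$, i.e. blocks of the form $x|_{[i,i+k)}$ with $x\in X$ (regarded as elements of $\Lambda^k$). A representation of $x$ as an infinite concatenation of blocks means that the set of all coordinates is partitioned into consecutive finite intervals and the blocks are the restrictions of $x$ to these intervals. For $B\in\Lambda^k$, $C\in\Lambda^l$ with $l\le k$, $\mathrm{Fr}_B(C)=\frac1k|\{i\in[0,k-l]: B|_{[i,i+l)}=C\}|$; if $l>k$, $\mathrm{Fr}_B(C)=0$. $\mathcal M(X)$ is the set of Borel probability measures on $X$, $\mathcal M_\sigma(X)$ the shift-invariant ones, $\mathcal M^{\mathsf{erg}}_\sigma(X)$ the ergodic ones. $[C]=\{x\in X: x|_{[0,l)}=C\}$ for $C\in\Lambda^l$. For $p\in\mathcal B^*(X)\cup\mathcal M(X)$ put $p(C)=\mathrm{Fr}_p(C)$ if $p$ is a block and $p(C)=p([C])$ if $p$ is a measure. The metric on $\mathcal B^*(X)\cup\mathcal M(X)$ is $d^*(p,q)=\sum_{l=1}^{\infty}2^{-l}\sum_{C\in\Lambda^l}|p(C)-q(C)|$.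 Upper Banach density of a set $A$ of coordinates: $\overline d_{\mathsf{Ban}}(A)=\inf_{N\in\mathbb N}\sup_i\frac{|A\cap[i,i+N)|}{N}$. *)

theory Defs
  imports "HOL-Probability.Probability"
begin

text \<open>
  The alphabet is a type \<open>'a\<close> of sort \<open>{finite, discrete_topology}\<close>, and a point is a function from
  the coordinates to \<open>'a\<close>, carrying the product topology.  The coordinates \<open>'i\<close> are \<^typ>\<open>int\<close>
  in the two-sided and \<^typ>\<open>nat\<close> in the one-sided case; the sort of \<open>'i\<close> below is one that
  both types have.  Blocks are lists over \<open>'a\<close>.
\<close>

definition shift :: "('i::linordered_euclidean_semiring \<Rightarrow> 'a) \<Rightarrow> 'i \<Rightarrow> 'a" where
  "shift x = (\<lambda>i. x (i + 1))"

definition two_sided_subshift :: "(int \<Rightarrow> 'a::discrete_topology) set \<Rightarrow> bool" where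
  "two_sided_subshift X \<longleftrightarrow> closed X \<and> shift ` X = X"

definition one_sided_subshift :: "(nat \<Rightarrow> 'a::discrete_topology) set \<Rightarrow> bool" where
  "one_sided_subshift X \<longleftrightarrow> closed X \<and> shift ` X \<subseteq> X"

text \<open>The restriction of \<open>x\<close> to \<open>[i, i + k)\<close>, as a block of length \<open>k\<close>.\<close>

definition window :: "('i::linordered_euclidean_semiring \<Rightarrow> 'a) \<Rightarrow> 'i \<Rightarrow> nat \<Rightarrow> 'a list" where
  "window x i k = map (\<lambda>j. x (i + of_nat j)) [0..<k]"

text \<open>The blocks occurring in \<open>X\<close>.  The empty block is excluded: frequencies in it are undefined.\<close>

definition blocks :: "('i::linordered_euclidean_semiring \<Rightarrow> 'a) set \<Rightarrow> 'a list set" where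
  "blocks X = {window x i k | x i k. x \<in> X \<and> 1 \<le> k}"

definition Fr :: "'a list \<Rightarrow> 'a list \<Rightarrow> real" where
  "Fr B C =
    (if length C \<le> length B
     then real (card {i \<in> {0..length B - length C}. take (length C) (drop i B) = C}) / real (length B)
     else 0)"

definition prob_measures ::
  "('i::linordered_euclidean_semiring \<Rightarrow> 'a::discrete_topology) set \<Rightarrow> ('i \<Rightarrow> 'a) measure set" where
  "prob_measures X = {\<mu>. prob_space \<mu> \<and> sets \<mu> = sets (restrict_space borel X)}"

definition invariant_measures ::
  "('i::linordered_euclidean_semiring \<Rightarrow> 'a::discrete_topology) set \<Rightarrow> ('i \<Rightarrow> 'a) measure set" where
  "invariant_measures X =
    {\<mu> \<in> prob_measures X. \<forall>E\<in>sets \<mu>. measure \<mu> (shift -` E \<inter> space \<mu>) = measure \<mu> E}"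

definition ergodic_measures ::
  "('i::linordered_euclidean_semiring \<Rightarrow> 'a::discrete_topology) set \<Rightarrow> ('i \<Rightarrow> 'a) measure set" where
  "ergodic_measures X =
    {\<mu> \<in> invariant_measures X.
       \<forall>E\<in>sets \<mu>. shift -` E \<inter> space \<mu> = E \<longrightarrow> measure \<mu> E = 0 \<or> measure \<mu> E = 1}"

text \<open>
  The number \<open>p(C)\<close> for a point \<open>p\<close> of the disjoint union of blocks and measures.
  For a measure \<open>\<mu>\<close> on \<open>X\<close> we have \<open>space \<mu> = X\<close>, so the set measured is the cylinder \<open>[C]\<close> in \<open>X\<close>.
\<close>

definition value_at ::
  "'a list + ('i::linordered_euclidean_semiring \<Rightarrow> 'a) measure \<Rightarrow> 'a list \<Rightarrow> real" where
  "value_at p C =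
    (case p of Inl B \<Rightarrow> Fr B C
     | Inr \<mu> \<Rightarrow> measure \<mu> {x \<in> space \<mu>. window x 0 (length C) = C})"

definition dstar ::
  "'a::finite list + ('i::linordered_euclidean_semiring \<Rightarrow> 'a) measure
     \<Rightarrow> 'a list + ('i \<Rightarrow> 'a) measure \<Rightarrow> real" where
  "dstar p q =
    (\<Sum>l. (1 / 2) ^ Suc l * (\<Sum>C | length C = Suc l. \<bar>value_at p C - value_at q C\<bar>))"

text \<open>
  Openness in the disjoint union of \<open>blocks X\<close> and \<open>prob_measures X\<close> with respect to \<open>dstar\<close>.
  It is spelled out with balls, rather than through \<open>Metric_space\<close>, because in the two-sided case
  \<open>dstar\<close> is only a pseudometric on all (not necessarily invariant) measures: it sees only the
  nonnegative coordinates.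
\<close>

definition dstar_open ::
  "('i::linordered_euclidean_semiring \<Rightarrow> 'a::{finite,discrete_topology}) set
     \<Rightarrow> ('a list + ('i \<Rightarrow> 'a) measure) set \<Rightarrow> bool" where
  "dstar_open X U \<longleftrightarrow>
    U \<subseteq> blocks X <+> prob_measures X \<and>
    (\<forall>p\<in>U. \<exists>r>0. \<forall>q \<in> blocks X <+> prob_measures X. dstar p q < r \<longrightarrow> q \<in> U)"

definition upper_Banach_density :: "'i::linordered_euclidean_semiring set \<Rightarrow> real" where
  "upper_Banach_density A =
    (INF N\<in>{1::nat..}. SUP i. real (card (A \<inter> {i..<i + of_nat N})) / real N)"

text \<open>
  A partition of the coordinates into consecutive finite, possibly empty, intervals
  \<open>[c k, c (k + 1))\<close>, where \<open>k\<close> ranges over \<^typ>\<open>int\<close> or \<^typ>\<open>nat\<close>, respectively.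
\<close>

definition cut_points :: "('i::linordered_euclidean_semiring \<Rightarrow> 'i) \<Rightarrow> bool" where
  "cut_points c \<longleftrightarrow> mono c \<and> (\<Union>k. {c k..<c (k + 1)}) = UNIV"

definition piece ::
  "('i::linordered_euclidean_semiring \<Rightarrow> 'a) \<Rightarrow> ('i \<Rightarrow> 'i) \<Rightarrow> 'i \<Rightarrow> 'a list" where
  "piece x c k = window x (c k) (card {c k..<c (k + 1)})"

text \<open>
  The pieces number \<open>0, 1, 2, 3, \<dots>\<close> are \<open>A\<^sub>1, B\<^sub>1, A\<^sub>2, B\<^sub>2, \<dots>\<close>, and, in the two-sided case, the pieces
  number \<open>-1, -2, -3, -4, \<dots>\<close> are \<open>A\<^sub>-\<^sub>1, B\<^sub>-\<^sub>1, A\<^sub>-\<^sub>2, B\<^sub>-\<^sub>2, \<dots>\<close>.  So the pieces \<open>B\<^sub>j\<close> are those with an odd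
  nonnegative or an even negative number; \<open>A\<^sub>-\<^sub>1\<close> and \<open>A\<^sub>1\<close> are adjacent.
\<close>

definition B_indices :: "'i::linordered_euclidean_semiring set" where
  "B_indices = {k. if 0 \<le> k then odd k else even k}"

definition A_coordinates :: "('i::linordered_euclidean_semiring \<Rightarrow> 'i) \<Rightarrow> 'i set" where
  "A_coordinates c = (\<Union>k\<in>- B_indices. {c k..<c (k + 1)})"

end

theory Submission
  imports Defs
begin

text \<open>
  It suffices to find a length \<open>L\<close> such that in every point of \<open>X\<close> all but a fraction \<open>\<epsilon>\<close> of \<open>[0, L)\<close>
  can be packed with disjoint good blocks, i.e. blocks in \<open>\<U>\<close> of length at least \<open>m\<close>: then one
  packs each interval \<open>[j L, (j + 1) L)\<close> separately.  A greedy packing leaves out only the positions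
  (and at most \<open>n\<close> more) at which no good block of length at most \<open>n\<close> starts, i.e. the visits to a
  clopen set \<open>F n\<close>.  If no \<open>L\<close> worked, limits of empirical measures would give an invariant measure
  with \<open>\<nu> (F n) \<ge> \<epsilon>\<close> for all \<open>n\<close>, and hence an extreme, thus ergodic, invariant measure for which
  \<open>\<nu> (F n)\<close> stays bounded away from \<open>0\<close>.  But an ergodic measure lies in the open set \<open>\<U>\<close>, and
  by the ergodic theorem in probability, which follows from extremality by compactness, the initial
  block of length \<open>k\<close> is close to it outside a set whose measure tends to \<open>0\<close>.

  Measures enter mostly as finitely additive contents on the algebra of clopen subsets of \<open>X\<close>.  They
  form a compact set in the product topology, and by compactness of \<open>X\<close> each of them extends to a
  Borel measure.
\<close>

section \<open>Contents on the clopen algebra\<close>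

text \<open>The obstacle is that the intersection of the sets \<open>F n\<close> need not be clopen,
  so that \<open>\<nu> \<mapsto> lim \<nu> (F n)\<close> is only upper semicontinuous for
  convergence on clopen sets. Such an affine function still attains its maximum over a compact
  convex set at an extreme point; adding a continuous strictly convex functional forces every
  maximiser to be extreme, and this takes the place of an ergodic decomposition. In the same spirit
  no almost everywhere convergence is involved: it is enough to bound excessive visits to a clopen
  set, because passing to the complement gives the opposite bound, and a persistent excess would
  itself produce a second invariant content below a multiple of the first. All limits come from the
  finite intersection property. Evaluation at a clopen set is a coordinate projection, hence
  continuous, which is why invariance, additivity and domination survive in the limit. Packing cells
  of one common length makes the bound on the block lengths uniform in the point and reduces the
  upper Banach density to a count: an interval of length \<open>L\<close> lies in two adjacent
  cells.\<close>

lemma compact_UNIV_fun: "compact (UNIV :: ('i \<Rightarrow> 'a::{finite,discrete_topology}) set)"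
proof -
  have "compactin (product_topology (\<lambda>i::'i. euclidean::'a topology) UNIV) (PiE UNIV (\<lambda>_. UNIV))"
    by (subst compactin_PiE) (simp add: finite_imp_compact)
  then show ?thesis
    by (simp add: euclidean_product_topology PiE_UNIV_domain)
qed

text \<open>Tychonoff's theorem, used with sets of points as indices: contents take values in
  \<open>[0, 1]\<close> and vanish off the algebra, so they all lie in this cube.\<close>

lemma compact_unit_cube: "compact {\<nu> :: 'b \<Rightarrow> real. \<forall>A. 0 \<le> \<nu> A \<and> \<nu> A \<le> 1}"
proof -
  have "compactin (product_topology (\<lambda>i::'b. euclidean::real topology) UNIV) (PiE UNIV (\<lambda>_. {0..1}))"
    by (subst compactin_PiE) simp
  moreover have "PiE UNIV (\<lambda>_::'b. {0..1::real}) = {\<nu>. \<forall>A. 0 \<le> \<nu> A \<and> \<nu> A \<le> 1}"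
    by (auto simp: PiE_UNIV_domain)
  ultimately show ?thesis
    by (simp add: euclidean_product_topology)
qed

text \<open>For closed \<open>X\<close> over a finite alphabet these are the relatively clopen
  subsets of \<open>X\<close>. The implication in one direction is easier to establish; exchanging
  \<open>x\<close> and \<open>y\<close> turns it into the equivalence of
  \<open>finitary_setsE\<close>.\<close>

definition finitary_sets :: "('i \<Rightarrow> 'a) set \<Rightarrow> ('i \<Rightarrow> 'a) set set" where
  "finitary_sets X = {A. A \<subseteq> X \<and>
     (\<exists>F. finite F \<and> (\<forall>x\<in>X. \<forall>y\<in>X. (\<forall>i\<in>F. x i = y i) \<longrightarrow> x \<in> A \<longrightarrow> y \<in> A))}"

lemma finitary_setsI:
  assumes "A \<subseteq> X" "finite F"
    "\<And>x y. x \<in> X \<Longrightarrow> y \<in> X \<Longrightarrow> \<forall>i\<in>F. x i = y i \<Longrightarrow> x \<in> A \<Longrightarrow> y \<in> A"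
  shows "A \<in> finitary_sets X"
  using assms unfolding finitary_sets_def by blast

lemma finitary_setsE:
  assumes "A \<in> finitary_sets X"
  obtains F where "A \<subseteq> X" "finite F"
    "\<forall>x\<in>X. \<forall>y\<in>X. (\<forall>i\<in>F. x i = y i) \<longrightarrow> (x \<in> A \<longleftrightarrow> y \<in> A)"
proof -
  obtain F where F: "A \<subseteq> X" "finite F"
    "\<forall>x\<in>X. \<forall>y\<in>X. (\<forall>i\<in>F. x i = y i) \<longrightarrow> x \<in> A \<longrightarrow> y \<in> A"
    using assms unfolding finitary_sets_def by auto
  have "\<forall>x\<in>X. \<forall>y\<in>X. (\<forall>i\<in>F. x i = y i) \<longrightarrow> (x \<in> A \<longleftrightarrow> y \<in> A)"
    using F(3) by (metis (full_types))
  with F show thesis using that by blast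
qed

lemma algebra_finitary_sets: "algebra X (finitary_sets X)"
  unfolding algebra_iff_Un
proof (intro conjI ballI)
  show "finitary_sets X \<subseteq> Pow X"
    by (auto simp: finitary_sets_def)
  show "{} \<in> finitary_sets X"
    by (rule finitary_setsI[of _ _ "{}"]) auto
next
  fix A assume "A \<in> finitary_sets X"
  then show "X - A \<in> finitary_sets X"
  proof (rule finitary_setsE)
    fix F assume "finite F" and *: "\<forall>x\<in>X. \<forall>y\<in>X. (\<forall>i\<in>F. x i = y i) \<longrightarrow> (x \<in> A \<longleftrightarrow> y \<in> A)"
    show ?thesis
    proof (rule finitary_setsI[OF _ \<open>finite F\<close>])
      fix x y assume "x \<in> X" "y \<in> X" "\<forall>i\<in>F. x i = y i" "x \<in> X - A"
      then show "y \<in> X - A" using * by blast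
    qed auto
  qed
next
  fix A B assume "A \<in> finitary_sets X" "B \<in> finitary_sets X"
  from this(1) obtain F where "A \<subseteq> X" "finite F"
    and A: "\<forall>x\<in>X. \<forall>y\<in>X. (\<forall>i\<in>F. x i = y i) \<longrightarrow> (x \<in> A \<longleftrightarrow> y \<in> A)"
    by (rule finitary_setsE)
  from \<open>B \<in> finitary_sets X\<close> obtain G where "B \<subseteq> X" "finite G"
    and B: "\<forall>x\<in>X. \<forall>y\<in>X. (\<forall>i\<in>G. x i = y i) \<longrightarrow> (x \<in> B \<longleftrightarrow> y \<in> B)"
    by (rule finitary_setsE)
  note FG = \<open>finite F\<close> \<open>finite G\<close> \<open>A \<subseteq> X\<close> \<open>B \<subseteq> X\<close>
  show "A \<union> B \<in> finitary_sets X"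
  proof (intro finitary_setsI[of _ _ "F \<union> G"])
    fix x y assume "x \<in> X" "y \<in> X" "\<forall>i\<in>F \<union> G. x i = y i" "x \<in> A \<union> B"
    then show "y \<in> A \<union> B"
      using A B by blast
  qed (use FG in auto)
qed

text \<open>Such a set is determined by a finite set \<open>F\<close> of coordinates and a set of
  patterns on \<open>F\<close>. Countability serves twice: relatively open sets become countable
  unions of finitary ones, and the algebra can be enumerated in the strictly convex functional of
  \<open>exists_extremal\<close>.\<close>

lemma countable_finitary_sets:
  "countable (finitary_sets (X :: ('i::countable \<Rightarrow> 'a::finite) set))"
proof (rule countable_subset)
  show "finitary_sets X \<subseteq>
    (\<Union>F\<in>{F. finite F}. (\<lambda>R. {x\<in>X. restrict x F \<in> R}) ` Pow (F \<rightarrow>\<^sub>E UNIV))"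
  proof
    fix A assume "A \<in> finitary_sets X"
    then obtain F where F: "A \<subseteq> X" "finite F"
      "\<forall>x\<in>X. \<forall>y\<in>X. (\<forall>i\<in>F. x i = y i) \<longrightarrow> (x \<in> A \<longleftrightarrow> y \<in> A)"
      by (rule finitary_setsE)
    have "A = {x\<in>X. restrict x F \<in> (\<lambda>x. restrict x F) ` A}"
    proof
      show "{x\<in>X. restrict x F \<in> (\<lambda>x. restrict x F) ` A} \<subseteq> A"
      proof
        fix x assume "x \<in> {x\<in>X. restrict x F \<in> (\<lambda>x. restrict x F) ` A}"
        then obtain y where "x \<in> X" "y \<in> A" "restrict x F = restrict y F" by auto
        then show "x \<in> A"
          using F(1,3) by (metis (no_types, lifting) restrict_apply' subsetD)
      qed
    qed (use F(1) in auto)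
    moreover have "(\<lambda>x. restrict x F) ` A \<in> Pow (F \<rightarrow>\<^sub>E UNIV)" by auto
    ultimately show "A \<in> (\<Union>F\<in>{F. finite F}. (\<lambda>R. {x\<in>X. restrict x F \<in> R}) ` Pow (F \<rightarrow>\<^sub>E UNIV))"
      using F(2) by blast
  qed
  show "countable (\<Union>F\<in>{F. finite F}. (\<lambda>R. {x\<in>X. restrict x F \<in> R}) ` Pow (F \<rightarrow>\<^sub>E (UNIV::'a set)))"
    by (intro countable_UN countable_image countable_Collect_finite countable_finite
        finite_Pow_iff[THEN iffD2] finite_PiE) auto
qed

lemma closed_finitary_set:
  fixes X :: "('i \<Rightarrow> 'a::{finite,discrete_topology}) set"
  assumes "closed X" "A \<in> finitary_sets X"
  shows "closed A"
proof -
  obtain F where F: "A \<subseteq> X" "finite F"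
    "\<forall>x\<in>X. \<forall>y\<in>X. (\<forall>i\<in>F. x i = y i) \<longrightarrow> (x \<in> A \<longleftrightarrow> y \<in> A)"
    using assms(2) by (rule finitary_setsE)
  have 1: "open {y :: 'i \<Rightarrow> 'a. y i = c}" for i c
  proof -
    have "open ((\<lambda>y :: 'i \<Rightarrow> 'a. y i) -` {c})"
      by (intro open_vimage discrete_topology_class.open_discrete continuous_on_product_coordinates)
    then show ?thesis by (simp add: vimage_def)
  qed
  have "- A = - X \<union> (\<Union>x\<in>X - A. \<Inter>i\<in>F. {y. y i = x i})"
  proof (intro set_eqI iffI)
    fix y assume "y \<in> - X \<union> (\<Union>x\<in>X - A. \<Inter>i\<in>F. {y. y i = x i})"
    then show "y \<in> - A"
      using F(1,3) by auto
  qed auto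
  moreover have "open \<dots>"
    using assms(1) F(2) 1 by (intro open_Un open_UN open_INT ballI) auto
  ultimately show ?thesis by (simp add: closed_def)
qed

text \<open>A basic open box restricts finitely many coordinates only; fixing these as in a given
  point yields a finitary neighbourhood inside the box. So a relatively open set is the union of the
  finitary sets in it, and this union is countable.\<close>

lemma sigma_finitary_sets:
  fixes X :: "('i::countable \<Rightarrow> 'a::{finite,discrete_topology}) set"
  assumes "closed X"
  shows "sigma_sets X (finitary_sets X) = sets (restrict_space borel X)"
proof -
  interpret algebra X "finitary_sets X" by (rule algebra_finitary_sets)
  have "sets (restrict_space borel X) = (\<inter>) X ` sigma_sets UNIV {S. open S}"
    by (simp add: sets_restrict_space borel_def)
  also have "\<dots> = sigma_sets X ((\<inter>) X ` {S. open S})"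
    using assms borel_closed[of X] by (intro sigma_sets_Int) (auto simp: borel_def)
  also have "\<dots> = sigma_sets X (finitary_sets X)"
  proof (rule sigma_sets_eqI)
    fix S' assume "S' \<in> (\<inter>) X ` {S. open S}"
    then obtain S where S: "open S" "S' = X \<inter> S" by auto
    have "S' = \<Union>{B\<in>finitary_sets X. B \<subseteq> S}"
    proof
      show "S' \<subseteq> \<Union>{B\<in>finitary_sets X. B \<subseteq> S}"
      proof
        fix x assume x: "x \<in> S'"
        obtain V where V: "x \<in> (\<Pi>\<^sub>E i\<in>UNIV. V i)" "finite {i. V i \<noteq> UNIV}" "(\<Pi>\<^sub>E i\<in>UNIV. V i) \<subseteq> S"
          using product_topology_open_contains_basis[of "\<lambda>_. euclidean" UNIV S x] S x
          by (auto simp: euclidean_product_topology)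
        define B where "B = {y\<in>X. \<forall>i\<in>{i. V i \<noteq> UNIV}. y i = x i}"
        have "B \<in> finitary_sets X"
          by (rule finitary_setsI[OF _ V(2)]) (auto simp: B_def)
        moreover have "B \<subseteq> S"
        proof
          fix y assume y: "y \<in> B"
          have "y i \<in> V i" for i
            using V(1) y by (cases "V i = UNIV") (auto simp: B_def)
          then show "y \<in> S" using V(3) by (auto simp: PiE_UNIV_domain)
        qed
        moreover have "x \<in> B" using x S by (auto simp: B_def)
        ultimately show "x \<in> \<Union>{B\<in>finitary_sets X. B \<subseteq> S}" by blast
      qed
    qed (use S sets_into_space in auto)
    moreover have "\<Union>{B\<in>finitary_sets X. B \<subseteq> S} \<in> sigma_sets X (finitary_sets X)"
      by (intro sigma_sets_UNION countable_subset[OF _ countable_finitary_sets]) auto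
    ultimately show "S' \<in> sigma_sets X (finitary_sets X)" by simp
  next
    fix A assume A: "A \<in> finitary_sets X"
    have "open (- A)" using closed_finitary_set[OF assms A] by auto
    then have "X \<inter> (- A) \<in> sigma_sets X ((\<inter>) X ` {S. open S})" by blast
    then have "X - (X \<inter> (- A)) \<in> sigma_sets X ((\<inter>) X ` {S. open S})" by (rule sigma_sets.Compl)
    moreover have "X - (X \<inter> (- A)) = A" using sets_into_space[OF A] by auto
    ultimately show "A \<in> sigma_sets X ((\<inter>) X ` {S. open S})" by simp
  qed
  finally show ?thesis by simp
qed

text \<open>By compactness a decreasing sequence with empty intersection is eventually empty.
  Continuity at the empty set, the condition in Caratheodory's extension theorem, thus holds for
  every finitely additive content.\<close>

lemma finitary_decseq_empty:
  fixes X :: "('i \<Rightarrow> 'a::{finite,discrete_topology}) set"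
  assumes "closed X" "range A \<subseteq> finitary_sets X" "decseq A" "(\<Inter>i. A i) = {}"
  shows "\<exists>n. A n = {}"
proof (rule ccontr)
  assume *: "\<nexists>n. A n = {}"
  have "UNIV \<inter> (\<Inter>i\<in>UNIV. A i) \<noteq> {}"
  proof (rule compact_imp_fip_image[OF compact_UNIV_fun])
    show "closed (A i)" for i
      by (rule closed_finitary_set[OF assms(1)]) (use assms(2) in blast)
    fix I :: "nat set" assume "finite I"
    then have "i \<le> Max (insert 0 I)" if "i \<in> I" for i
      using that by simp
    then have "A (Max (insert 0 I)) \<subseteq> (\<Inter>i\<in>I. A i)"
      by (intro INT_greatest decseqD[OF assms(3)])
    then show "UNIV \<inter> (\<Inter>i\<in>I. A i) \<noteq> {}" using * by blast
  qed
  then show False using assms(4) by simp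
qed

text \<open>Contents are set to \<open>0\<close> off the algebra, so that two of them are equal as functions as soon as
  they agree on the algebra.\<close>

definition fa_prob :: "('i \<Rightarrow> 'a) set \<Rightarrow> (('i \<Rightarrow> 'a) set \<Rightarrow> real) \<Rightarrow> bool" where
  "fa_prob X \<nu> \<longleftrightarrow>
    (\<forall>A\<in>finitary_sets X. 0 \<le> \<nu> A) \<and> (\<forall>A\<in>- finitary_sets X. \<nu> A = 0) \<and> \<nu> X = 1 \<and>
    (\<forall>A\<in>finitary_sets X. \<forall>B\<in>{B \<in> finitary_sets X. A \<inter> B = {}}. \<nu> (A \<union> B) = \<nu> A + \<nu> B)"

lemma fa_prob_mono:
  assumes "fa_prob X \<nu>" "A \<in> finitary_sets X" "B \<in> finitary_sets X" "A \<subseteq> B"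
  shows "\<nu> A \<le> \<nu> B"
proof -
  interpret algebra X "finitary_sets X" by (rule algebra_finitary_sets)
  have "B - A \<in> finitary_sets X" using assms by auto
  moreover have "\<nu> (A \<union> (B - A)) = \<nu> A + \<nu> (B - A)"
    using assms calculation unfolding fa_prob_def by blast
  moreover have "A \<union> (B - A) = B" using assms by auto
  ultimately show ?thesis using assms(1) by (auto simp: fa_prob_def)
qed

lemma fa_prob_bounds:
  assumes "fa_prob X \<nu>"
  shows "0 \<le> \<nu> A" "\<nu> A \<le> 1"
proof -
  interpret algebra X "finitary_sets X" by (rule algebra_finitary_sets)
  have "0 \<le> \<nu> A \<and> \<nu> A \<le> 1"
  proof (cases "A \<in> finitary_sets X")
    case True
    then have "\<nu> A \<le> \<nu> X" using fa_prob_mono[OF assms True top] sets_into_space by auto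
    then show ?thesis using assms True by (simp add: fa_prob_def)
  next
    case False
    then show ?thesis using assms by (simp add: fa_prob_def)
  qed
  then show "0 \<le> \<nu> A" "\<nu> A \<le> 1" by auto
qed

lemma fa_prob_extends:
  fixes X :: "('i::{linordered_euclidean_semiring,countable} \<Rightarrow> 'a::{finite,discrete_topology}) set"
  assumes "closed X" "fa_prob X \<nu>"
  obtains \<mu> where "\<mu> \<in> prob_measures X" "\<And>A. A \<in> finitary_sets X \<Longrightarrow> measure \<mu> A = \<nu> A"
proof -
  interpret algebra X "finitary_sets X" by (rule algebra_finitary_sets)
  note \<nu> = assms(2)[unfolded fa_prob_def]
  have 0: "\<nu> {} = 0"
    using \<nu> empty_sets by (metis (mono_tags, lifting) Int_empty_left Un_empty add_cancel_right_right mem_Collect_eq)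
  have "\<exists>\<mu>. (\<forall>A\<in>finitary_sets X. \<mu> A = ennreal (\<nu> A)) \<and> measure_space X (sigma_sets X (finitary_sets X)) \<mu>"
  proof (rule caratheodory_empty_continuous)
    show "positive (finitary_sets X) (\<lambda>A. ennreal (\<nu> A))"
      by (simp add: positive_def 0)
    show "additive (finitary_sets X) (\<lambda>A. ennreal (\<nu> A))"
      using \<nu> by (simp add: additive_def flip: ennreal_plus)
    fix A :: "nat \<Rightarrow> ('i \<Rightarrow> 'a) set"
    assume A: "range A \<subseteq> finitary_sets X" "decseq A" "\<Inter> (range A) = {}"
    then obtain n where "A n = {}" using finitary_decseq_empty[OF assms(1)] by metis
    then have "A i = {}" if "i \<ge> n" for i using A(2) that by (auto simp: decseq_def)
    then have "eventually (\<lambda>i. ennreal (\<nu> (A i)) = 0) sequentially"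
      unfolding eventually_sequentially using 0 by (intro exI[of _ n]) simp
    then show "(\<lambda>i. ennreal (\<nu> (A i))) \<longlonglongrightarrow> 0" by (rule tendsto_eventually)
  qed simp
  then obtain \<mu> where \<mu>: "\<And>A. A \<in> finitary_sets X \<Longrightarrow> \<mu> A = ennreal (\<nu> A)"
    "measure_space X (sigma_sets X (finitary_sets X)) \<mu>" by blast
  define M where "M = measure_of X (finitary_sets X) \<mu>"
  have M: "space M = X" "sets M = sigma_sets X (finitary_sets X)"
    using space_closed by (auto simp: M_def)
  have em: "emeasure M A = ennreal (\<nu> A)" if "A \<in> finitary_sets X" for A
  proof -
    have "emeasure M A = \<mu> A"
      using \<mu>(2) that space_closed
      by (intro emeasure_measure_of[OF M_def]) (auto simp: measure_space_def M(2))
    then show ?thesis using \<mu>(1)[OF that] by simp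
  qed
  have "emeasure M X = 1" using em[OF top] \<nu> by simp
  then have "prob_space M" by (intro prob_spaceI) (simp add: M)
  then have "M \<in> prob_measures X"
    by (simp add: prob_measures_def M sigma_finitary_sets[OF assms(1)])
  moreover have "measure M A = \<nu> A" if "A \<in> finitary_sets X" for A
    using em[OF that] fa_prob_bounds[OF assms(2)] by (simp add: measure_def)
  ultimately show thesis by (rule that)
qed

lemma shift_vimage_finitary:
  assumes "shift ` X \<subseteq> X" "A \<in> finitary_sets X"
  shows "shift -` A \<inter> X \<in> finitary_sets X"
proof -
  obtain F where F: "A \<subseteq> X" "finite F"
    "\<forall>x\<in>X. \<forall>y\<in>X. (\<forall>i\<in>F. x i = y i) \<longrightarrow> (x \<in> A \<longleftrightarrow> y \<in> A)"
    using assms(2) by (rule finitary_setsE)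
  show ?thesis
  proof (rule finitary_setsI)
    show "finite ((\<lambda>i. i + 1) ` F)" using F(2) by simp
    fix x y assume *: "x \<in> X" "y \<in> X" "\<forall>i\<in>(\<lambda>i. i + 1) ` F. x i = y i" "x \<in> shift -` A \<inter> X"
    then have "shift x \<in> X" "shift y \<in> X" "\<forall>i\<in>F. shift x i = shift y i"
      using assms(1) by (auto simp: shift_def)
    then show "y \<in> shift -` A \<inter> X" using F(3) * by blast
  qed auto
qed

lemma prob_measures_simps:
  assumes "\<mu> \<in> prob_measures X"
  shows "prob_space \<mu>" "space \<mu> = X" "sets \<mu> = sets (restrict_space borel X)"
  using assms sets_eq_imp_space_eq[of \<mu> "restrict_space borel X"]
  by (auto simp: prob_measures_def space_restrict_space)

lemma finitary_sets_measurable: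
  fixes X :: "('i::{linordered_euclidean_semiring,countable} \<Rightarrow> 'a::{finite,discrete_topology}) set"
  assumes "closed X" "\<mu> \<in> prob_measures X" "A \<in> finitary_sets X"
  shows "A \<in> sets \<mu>"
  using assms prob_measures_simps(3)[OF assms(2)] by (auto simp flip: sigma_finitary_sets)

lemma prob_measures_eqI:
  fixes X :: "('i::{linordered_euclidean_semiring,countable} \<Rightarrow> 'a::{finite,discrete_topology}) set"
  assumes "closed X" "\<mu> \<in> prob_measures X" "\<mu>' \<in> prob_measures X"
    and "\<And>A. A \<in> finitary_sets X \<Longrightarrow> measure \<mu> A = measure \<mu>' A"
  shows "\<mu> = \<mu>'"
proof -
  interpret algebra X "finitary_sets X" by (rule algebra_finitary_sets)
  interpret \<mu>: prob_space \<mu> by (rule prob_measures_simps[OF assms(2)])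
  interpret \<mu>': prob_space \<mu>' by (rule prob_measures_simps[OF assms(3)])
  show ?thesis
  proof (rule measure_eqI_generator_eq[where E = "finitary_sets X" and \<Omega> = X and A = "\<lambda>_::nat. X"])
    show "Int_stable (finitary_sets X)" by (auto simp: Int_stable_def)
    show "sets \<mu> = sigma_sets X (finitary_sets X)" "sets \<mu>' = sigma_sets X (finitary_sets X)"
      using prob_measures_simps(3)[OF assms(2)] prob_measures_simps(3)[OF assms(3)]
      by (simp_all add: sigma_finitary_sets[OF assms(1)])
  qed (use assms(4) space_closed in \<open>auto simp: \<mu>.emeasure_eq_measure \<mu>'.emeasure_eq_measure\<close>)
qed

lemma shift_measurable:
  fixes X :: "('i::{linordered_euclidean_semiring,countable} \<Rightarrow> 'a::{finite,discrete_topology}) set"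
  assumes "closed X" "shift ` X \<subseteq> X" "\<mu> \<in> prob_measures X"
  shows "shift \<in> measurable \<mu> \<mu>"
proof (rule measurable_sigma_sets)
  note sp = prob_measures_simps(2)[OF assms(3)]
  show "sets \<mu> = sigma_sets X (finitary_sets X)"
    by (simp add: sigma_finitary_sets[OF assms(1)] prob_measures_simps[OF assms(3)])
  show "finitary_sets X \<subseteq> Pow X" by (auto simp: finitary_sets_def)
  show "shift \<in> space \<mu> \<rightarrow> X" using assms(2) sp by auto
  show "shift -` A \<inter> space \<mu> \<in> sets \<mu>" if "A \<in> finitary_sets X" for A
    using shift_vimage_finitary[OF assms(2) that] finitary_sets_measurable[OF assms(1,3)] sp by simp
qed

text \<open>The image of \<open>\<mu>\<close> under the shift is again a probability measure on
  \<open>X\<close>, and two of these agree once they agree on the generating algebra.\<close>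

lemma invariant_measuresI:
  fixes X :: "('i::{linordered_euclidean_semiring,countable} \<Rightarrow> 'a::{finite,discrete_topology}) set"
  assumes "closed X" "shift ` X \<subseteq> X" "\<mu> \<in> prob_measures X"
    and inv: "\<And>A. A \<in> finitary_sets X \<Longrightarrow> measure \<mu> (shift -` A \<inter> X) = measure \<mu> A"
  shows "\<mu> \<in> invariant_measures X"
proof -
  interpret prob_space \<mu> by (rule prob_measures_simps[OF assms(3)])
  note sp = prob_measures_simps(2)[OF assms(3)]
  note meas = shift_measurable[OF assms(1-3)]
  have "distr \<mu> \<mu> shift = \<mu>"
  proof (rule prob_measures_eqI[OF assms(1) _ assms(3)])
    show "distr \<mu> \<mu> shift \<in> prob_measures X"
      using prob_space_distr[OF meas] assms(3) by (simp add: prob_measures_def)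
    show "measure (distr \<mu> \<mu> shift) A = measure \<mu> A" if "A \<in> finitary_sets X" for A
      using measure_distr[OF meas finitary_sets_measurable[OF assms(1,3) that]] inv[OF that] sp by simp
  qed
  then have "measure \<mu> (shift -` E \<inter> space \<mu>) = measure \<mu> E" if "E \<in> sets \<mu>" for E
    using measure_distr[OF meas that] by simp
  then show ?thesis using assms(3) by (simp add: invariant_measures_def)
qed

definition inv_fa_prob :: "('i::linordered_euclidean_semiring \<Rightarrow> 'a) set \<Rightarrow> (('i \<Rightarrow> 'a) set \<Rightarrow> real) \<Rightarrow> bool" where
  "inv_fa_prob X \<nu> \<longleftrightarrow> fa_prob X \<nu> \<and> (\<forall>A\<in>finitary_sets X. \<nu> (shift -` A \<inter> X) = \<nu> A)"

lemma inv_fa_prob_extends: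
  fixes X :: "('i::{linordered_euclidean_semiring,countable} \<Rightarrow> 'a::{finite,discrete_topology}) set"
  assumes "closed X" "shift ` X \<subseteq> X" "inv_fa_prob X \<nu>"
  obtains \<mu> where "\<mu> \<in> invariant_measures X" "\<And>A. A \<in> finitary_sets X \<Longrightarrow> measure \<mu> A = \<nu> A"
proof -
  obtain \<mu> where \<mu>: "\<mu> \<in> prob_measures X" "\<And>A. A \<in> finitary_sets X \<Longrightarrow> measure \<mu> A = \<nu> A"
    using fa_prob_extends[OF assms(1)] assms(3) by (metis inv_fa_prob_def)
  have "\<mu> \<in> invariant_measures X"
    by (rule invariant_measuresI[OF assms(1,2) \<mu>(1)])
       (use assms(3) \<mu>(2) shift_vimage_finitary[OF assms(2)] in \<open>auto simp: inv_fa_prob_def\<close>)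
  then show thesis using that \<mu> by blast
qed

lemma inv_fa_prob_of_measure:
  fixes X :: "('i::{linordered_euclidean_semiring,countable} \<Rightarrow> 'a::{finite,discrete_topology}) set"
  assumes "closed X" "shift ` X \<subseteq> X" "\<mu> \<in> invariant_measures X"
  shows "inv_fa_prob X (\<lambda>A. if A \<in> finitary_sets X then measure \<mu> A else 0)"
proof -
  interpret algebra X "finitary_sets X" by (rule algebra_finitary_sets)
  have \<mu>: "\<mu> \<in> prob_measures X" using assms(3) by (simp add: invariant_measures_def)
  interpret \<mu>: prob_space \<mu> by (rule prob_measures_simps[OF \<mu>])
  note ms = finitary_sets_measurable[OF assms(1) \<mu>]
  have "measure \<mu> X = 1" using \<mu>.prob_space prob_measures_simps(2)[OF \<mu>] by simp
  moreover have "A \<union> B \<in> finitary_sets X" if "A \<in> finitary_sets X" "B \<in> finitary_sets X" for A B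
    using that by auto
  moreover have "measure \<mu> (shift -` A \<inter> X) = measure \<mu> A" if "A \<in> finitary_sets X" for A
    using assms(3) ms[OF that] prob_measures_simps(2)[OF \<mu>] by (simp add: invariant_measures_def)
  ultimately show ?thesis
    unfolding inv_fa_prob_def fa_prob_def
    using shift_vimage_finitary[OF assms(2)] ms \<mu>.finite_measure_Union by simp
qed

lemma closed_fa_prob: "closed {\<nu>. fa_prob X \<nu>}"
  unfolding fa_prob_def Collect_conj_eq Collect_ball_eq
  by (intro closed_Int closed_INT ballI closed_Collect_le closed_Collect_eq continuous_intros
      continuous_on_product_coordinates)

text \<open>Replaces the extraction of a convergent subsequence: the contents that satisfy
  constraint \<open>j\<close> and are invariant up to \<open>c / (j + 1)\<close> form a decreasing
  sequence of nonempty compact sets. Closedness is asked for only within the cube, where series such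
  as \<open>\<Psi>\<close> in \<open>exists_extremal\<close> converge uniformly.\<close>

lemma inv_fa_prob_limit:
  fixes S :: "nat \<Rightarrow> (('i::linordered_euclidean_semiring \<Rightarrow> 'a) set \<Rightarrow> real) set"
  assumes cl: "\<And>j. closed (S j \<inter> {\<nu>. \<forall>A. 0 \<le> \<nu> A \<and> \<nu> A \<le> 1})"
    and dec: "decseq S"
    and ex: "\<And>j. \<exists>\<eta>\<in>S j. fa_prob X \<eta> \<and>
      (\<forall>A\<in>finitary_sets X. \<bar>\<eta> (shift -` A \<inter> X) - \<eta> A\<bar> \<le> c / real (Suc j))"
  shows "\<exists>\<nu>. inv_fa_prob X \<nu> \<and> (\<forall>j. \<nu> \<in> S j)"
proof -
  define Q where "Q = {\<nu> :: ('i \<Rightarrow> 'a) set \<Rightarrow> real. \<forall>A. 0 \<le> \<nu> A \<and> \<nu> A \<le> 1}"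
  \<comment> \<open>With \<open>max c 0\<close> in place of \<open>c\<close> the error bounds do not
    increase with \<open>j\<close>, whatever the sign of \<open>c\<close>.\<close>
  define K where "K j = (S j \<inter> Q) \<inter> ({\<eta>. fa_prob X \<eta>} \<inter>
    {\<eta>. \<forall>A\<in>finitary_sets X. \<bar>\<eta> (shift -` A \<inter> X) - \<eta> A\<bar> \<le> max c 0 / real (Suc j)})" for j
  have "Q \<inter> (\<Inter>j\<in>UNIV. K j) \<noteq> {}"
  proof (rule compact_imp_fip_image)
    show "compact Q" unfolding Q_def by (rule compact_unit_cube)
    show "closed (K j)" for j
      unfolding K_def Collect_ball_eq
      by (intro closed_Int closed_fa_prob closed_INT ballI closed_Collect_le continuous_intros
        continuous_on_product_coordinates cl[folded Q_def])
    fix I :: "nat set" assume "finite I"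
    then have le: "i \<le> Max (insert 0 I)" if "i \<in> I" for i
      using that by simp
    have anti: "K j \<subseteq> K i" if "i \<le> j" for i j
    proof
      fix \<eta> assume \<eta>: "\<eta> \<in> K j"
      have "max c 0 / real (Suc j) \<le> max c 0 / real (Suc i)"
        using that by (intro divide_left_mono) auto
      then show "\<eta> \<in> K i"
        using \<eta> decseqD[OF dec that] unfolding K_def by fastforce
    qed
    obtain \<eta> where \<eta>: "\<eta> \<in> S (Max (insert 0 I))" "fa_prob X \<eta>"
      "\<forall>A\<in>finitary_sets X. \<bar>\<eta> (shift -` A \<inter> X) - \<eta> A\<bar> \<le> c / real (Suc (Max (insert 0 I)))"
      using ex by blast
    have "c / real (Suc (Max (insert 0 I))) \<le> max c 0 / real (Suc (Max (insert 0 I)))"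
      by (intro divide_right_mono) auto
    then have "\<forall>A\<in>finitary_sets X. \<bar>\<eta> (shift -` A \<inter> X) - \<eta> A\<bar> \<le> max c 0 / real (Suc (Max (insert 0 I)))"
      using \<eta>(3) order_trans by blast
    moreover have Q: "\<eta> \<in> Q" using fa_prob_bounds[OF \<eta>(2)] by (simp add: Q_def)
    ultimately have "\<eta> \<in> K (Max (insert 0 I))"
      using \<eta> by (simp add: K_def)
    then have "\<eta> \<in> Q \<inter> (\<Inter>i\<in>I. K i)"
      using Q anti[OF le] by blast
    then show "Q \<inter> (\<Inter>i\<in>I. K i) \<noteq> {}" by blast
  qed
  then obtain \<nu> where \<nu>: "\<And>j. \<nu> \<in> K j" by blast
  have "\<nu> (shift -` A \<inter> X) = \<nu> A" if A: "A \<in> finitary_sets X" for A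
  proof -
    have "(\<lambda>j. max c 0 * inverse (real (Suc j))) \<longlonglongrightarrow> max c 0 * 0"
      by (intro tendsto_intros LIMSEQ_inverse_real_of_nat)
    moreover have "\<bar>\<nu> (shift -` A \<inter> X) - \<nu> A\<bar> \<le> max c 0 * inverse (real (Suc j))" for j
      using \<nu>[of j] A by (simp add: K_def divide_inverse)
    ultimately have "\<bar>\<nu> (shift -` A \<inter> X) - \<nu> A\<bar> \<le> max c 0 * 0"
      by (intro LIMSEQ_le_const) auto
    then show ?thesis by simp
  qed
  then have "inv_fa_prob X \<nu>" using \<nu>[of 0] by (simp add: inv_fa_prob_def K_def)
  then show ?thesis using \<nu> unfolding K_def by blast
qed

section \<open>Extremal contents and ergodic measures\<close>

text \<open>Extreme points of the set of invariant contents, expressed through domination: a proper convex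
  combination \<open>\<nu> = t \<eta> + (1 - t) \<kappa>\<close> gives \<open>\<eta> \<le> \<nu> / t\<close>, and conversely.  Unlike convex
  combinations, domination passes to limits at once.\<close>

definition extremal :: "('i::linordered_euclidean_semiring \<Rightarrow> 'a) set \<Rightarrow> (('i \<Rightarrow> 'a) set \<Rightarrow> real) \<Rightarrow> bool" where
  "extremal X \<nu> \<longleftrightarrow> inv_fa_prob X \<nu> \<and>
    (\<forall>\<eta> C. inv_fa_prob X \<eta> \<longrightarrow> (\<forall>A\<in>finitary_sets X. \<eta> A \<le> C * \<nu> A) \<longrightarrow> \<eta> = \<nu>)"

text \<open>This is the other summand \<kappa> in
  \<open>\<nu> = (1 / D) \<eta> + (1 - 1 / D) \<kappa>\<close>; the domination says precisely that
  it is nonnegative.\<close>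

lemma inv_fa_prob_complement:
  assumes "inv_fa_prob X \<nu>" "inv_fa_prob X \<eta>" "shift ` X \<subseteq> X" "D > 1"
    and "\<And>A. A \<in> finitary_sets X \<Longrightarrow> \<eta> A \<le> D * \<nu> A"
  shows "inv_fa_prob X (\<lambda>A. (D * \<nu> A - \<eta> A) / (D - 1))"
proof -
  have "(D * \<nu> X - \<eta> X) / (D - 1) = 1"
    using assms by (simp add: inv_fa_prob_def fa_prob_def)
  then show ?thesis
    using assms shift_vimage_finitary[OF assms(3)]
    by (simp add: inv_fa_prob_def fa_prob_def add_divide_distrib diff_divide_distrib
        ring_distribs divide_right_mono)
qed

text \<open>The maximiser of \<open>c \<phi> + \<Psi>\<close>, where \<open>\<phi> \<nu> = lim \<nu> (F n)\<close> is affine and upper semicontinuous and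
  \<open>\<Psi>\<close> is continuous and strictly convex, is extremal.  Since \<open>0 \<le> \<Psi> \<le> 2\<close>, the choice
  \<open>c = 3 / \<epsilon>\<close> forces \<open>\<phi> > 0\<close> there.\<close>

lemma exists_extremal:
  fixes X :: "('i::{linordered_euclidean_semiring,countable} \<Rightarrow> 'a::{finite,discrete_topology}) set"
  assumes X: "shift ` X \<subseteq> X"
    and F: "\<And>n. F n \<in> finitary_sets X" "decseq F"
    and \<nu>0: "inv_fa_prob X \<nu>0" "\<And>n. \<epsilon> \<le> \<nu>0 (F n)" "\<epsilon> > 0"
  obtains \<nu> \<delta> where "extremal X \<nu>" "\<delta> > 0" "\<And>n. \<delta> \<le> \<nu> (F n)"
proof -
  define P where "P = Collect (inv_fa_prob X)"
  define Q where "Q = {\<nu> :: ('i \<Rightarrow> 'a) set \<Rightarrow> real. \<forall>A. 0 \<le> \<nu> A \<and> \<nu> A \<le> 1}"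
  define C where "C = from_nat_into (finitary_sets X)"
  \<comment> \<open>Since \<open>C\<close> runs through the whole algebra, the squares detect every
    difference between two contents; the geometric weights make the partial sums converge uniformly
    on \<open>Q\<close>.\<close>
  define \<Psi> where "\<Psi> \<nu> = (\<Sum>j. (1/2) ^ j * (\<nu> (C j))\<^sup>2)" for \<nu> :: "('i \<Rightarrow> 'a) set \<Rightarrow> real"
  define \<phi> where "\<phi> \<nu> = (INF n. \<nu> (F n))" for \<nu> :: "('i \<Rightarrow> 'a) set \<Rightarrow> real"
  define c where "c = 3 / \<epsilon>"
  have c: "c > 0" using \<nu>0(3) by (simp add: c_def)
  have PQ: "P \<subseteq> Q" using fa_prob_bounds by (auto simp: P_def Q_def inv_fa_prob_def)
  have range_C: "range C = finitary_sets X"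
    unfolding C_def using F(1) by (intro range_from_nat_into countable_finitary_sets) auto
  have geom: "summable (\<lambda>j. (1/2::real) ^ j)" "(\<Sum>j. (1/2::real) ^ j) = 2"
    using suminf_geometric[of "1/2::real"] by (auto intro: summable_geometric)
  have bd: "norm ((1/2) ^ j * (\<nu> (C j))\<^sup>2) \<le> (1/2::real) ^ j" if "\<nu> \<in> Q" for \<nu> j
    using that by (auto simp: Q_def abs_mult intro!: mult_left_le power_le_one)
  have sm: "summable (\<lambda>j. (1/2) ^ j * (\<nu> (C j))\<^sup>2)" if "\<nu> \<in> Q" for \<nu>
    by (rule summable_comparison_test'[OF geom(1) bd[OF that]])
  have \<Psi>0: "0 \<le> \<Psi> \<nu>" if "\<nu> \<in> Q" for \<nu>
    unfolding \<Psi>_def by (intro suminf_nonneg sm that) auto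
  have \<Psi>2: "\<Psi> \<nu> \<le> 2" if "\<nu> \<in> Q" for \<nu>
  proof -
    have "\<Psi> \<nu> \<le> (\<Sum>j. (1/2) ^ j)"
      unfolding \<Psi>_def by (intro suminf_le sm that geom(1)) (use bd[OF that] in auto)
    then show ?thesis by (simp only: geom(2))
  qed
  have cont: "continuous_on Q \<Psi>"
  proof (rule uniform_limit_theorem)
    show "uniform_limit Q (\<lambda>n \<nu>. \<Sum>j<n. (1/2) ^ j * (\<nu> (C j))\<^sup>2) \<Psi> sequentially"
      unfolding \<Psi>_def by (rule Weierstrass_m_test[OF bd geom(1)])
    show "\<forall>\<^sub>F n in sequentially. continuous_on Q (\<lambda>\<nu>. \<Sum>j<n. (1/2) ^ j * (\<nu> (C j))\<^sup>2)"
      by (intro always_eventually allI continuous_intros continuous_on_product_then_coordinatewise)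
  qed simp
  have lim: "(\<lambda>n. \<nu> (F n)) \<longlonglongrightarrow> \<phi> \<nu>" and \<phi>_le: "\<phi> \<nu> \<le> \<nu> (F n)" if "\<nu> \<in> P" for \<nu> n
  proof -
    have fa: "fa_prob X \<nu>" using that by (simp add: P_def inv_fa_prob_def)
    have "bdd_below (range (\<lambda>n. \<nu> (F n)))"
      by (rule bdd_belowI[of _ 0]) (use fa_prob_bounds[OF fa] in auto)
    moreover have "decseq (\<lambda>n. \<nu> (F n))"
      by (intro decseq_SucI fa_prob_mono[OF fa] F decseqD[OF F(2)]) simp
    ultimately show "(\<lambda>n. \<nu> (F n)) \<longlonglongrightarrow> \<phi> \<nu>" "\<phi> \<nu> \<le> \<nu> (F n)"
      unfolding \<phi>_def by (auto intro: LIMSEQ_decseq_INF cINF_lower)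
  qed
  have bdd: "bdd_above ((\<lambda>\<nu>. c * \<phi> \<nu> + \<Psi> \<nu>) ` P)"
  proof (rule bdd_aboveI2)
    fix \<nu> assume \<nu>: "\<nu> \<in> P"
    then have "\<nu> (F 0) \<le> 1" using PQ by (auto simp: Q_def)
    then have "\<phi> \<nu> \<le> 1" using \<phi>_le[OF \<nu>, of 0] by simp
    then have "c * \<phi> \<nu> \<le> c" using c by simp
    then show "c * \<phi> \<nu> + \<Psi> \<nu> \<le> c + 2" using \<Psi>2[of \<nu>] \<nu> PQ by auto
  qed
  define s where "s = (SUP \<nu>\<in>P. c * \<phi> \<nu> + \<Psi> \<nu>)"
  \<comment> \<open>The maximiser is found as a limit of near-maximisers. The value
    \<open>\<phi> \<nu>\<close> is replaced by finitely many values \<open>\<nu> (F i)\<close>,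
    which gives closed conditions, and the slack \<open>1 / (j + 1)\<close> is there because the
    supremum is not yet known to be attained.\<close>
  define S where "S j = {\<nu>. \<forall>i\<in>{..j}. s - 1 / real (Suc j) \<le> c * \<nu> (F i) + \<Psi> \<nu>}" for j
  have "\<exists>\<nu>. inv_fa_prob X \<nu> \<and> (\<forall>j. \<nu> \<in> S j)"
  \<comment> \<open>The error constant is \<open>0\<close> since the near-maximisers are themselves
    invariant.\<close>
  proof (rule inv_fa_prob_limit[of S X 0])
    show "closed (S j \<inter> {\<nu>. \<forall>A. 0 \<le> \<nu> A \<and> \<nu> A \<le> 1})" for j
    proof -
      have "closed Q" 
        unfolding Q_def by (intro closed_Collect_all closed_Collect_conj closed_Collect_le
          continuous_intros continuous_on_product_coordinates)
      have "closed {\<nu>\<in>Q. s - 1 / real (Suc j) \<le> c * \<nu> (F i) + \<Psi> \<nu>}" for i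
        by (intro continuous_on_closed_Collect_le continuous_intros cont \<open>closed Q\<close>
          continuous_on_product_then_coordinatewise)
      then have "closed (Q \<inter> (\<Inter>i\<in>{..j}. {\<nu>\<in>Q. s - 1 / real (Suc j) \<le> c * \<nu> (F i) + \<Psi> \<nu>}))"
        using \<open>closed Q\<close> by blast
      moreover have "Q \<inter> (\<Inter>i\<in>{..j}. {\<nu>\<in>Q. s - 1 / real (Suc j) \<le> c * \<nu> (F i) + \<Psi> \<nu>}) = S j \<inter> Q"
        by (auto simp: S_def)
      ultimately show ?thesis by (simp add: Q_def)
    qed
    show "decseq S"
    proof (rule decseq_SucI)
      fix j
      have "1 / real (Suc (Suc j)) \<le> 1 / real (Suc j)" by (intro divide_left_mono) auto
      then have le: "s - 1 / real (Suc j) \<le> s - 1 / real (Suc (Suc j))" by simp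
      show "S (Suc j) \<le> S j"
      proof
        fix \<nu> assume \<nu>: "\<nu> \<in> S (Suc j)"
        show "\<nu> \<in> S j"
          unfolding S_def
        proof (intro CollectI ballI)
          fix i assume "i \<in> {..j}"
          then show "s - 1 / real (Suc j) \<le> c * \<nu> (F i) + \<Psi> \<nu>"
            using \<nu> by (intro order_trans[OF le]) (auto simp: S_def)
        qed
      qed
    qed
    show "\<exists>\<eta>\<in>S j. fa_prob X \<eta> \<and>
      (\<forall>A\<in>finitary_sets X. \<bar>\<eta> (shift -` A \<inter> X) - \<eta> A\<bar> \<le> 0 / real (Suc j))" for j
    proof -
      have "s - 1 / real (Suc j) < s" by simp
      then obtain \<eta> where \<eta>: "\<eta> \<in> P" "s - 1 / real (Suc j) < c * \<phi> \<eta> + \<Psi> \<eta>"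
        using less_cSUP_iff[OF _ bdd] \<nu>0(1) unfolding s_def P_def by blast
      have "c * \<phi> \<eta> \<le> c * \<eta> (F i)" for i
        using \<phi>_le[OF \<eta>(1)] c by simp
      then have "c * \<phi> \<eta> + \<Psi> \<eta> \<le> c * \<eta> (F i) + \<Psi> \<eta>" for i by simp
      then have "\<eta> \<in> S j"
        unfolding S_def using order_trans[OF less_imp_le[OF \<eta>(2)]] by blast
      then show ?thesis using \<eta>(1) by (auto simp: P_def inv_fa_prob_def)
    qed
  qed
  then obtain \<nu> where \<nu>: "inv_fa_prob X \<nu>" "\<And>j. \<nu> \<in> S j" by blast
  have \<nu>P: "\<nu> \<in> P" and \<nu>Q: "\<nu> \<in> Q" using \<nu>(1) PQ by (auto simp: P_def)
  \<comment> \<open>Here \<open>i\<close> is fixed and \<open>j\<close> tends to infinity, which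
    removes the slack; only afterwards does \<open>i\<close> tend to infinity.\<close>
  have s_le: "s - \<Psi> \<nu> \<le> c * \<nu> (F i)" for i
  proof (rule LIMSEQ_le_const)
    show "(\<lambda>j. c * \<nu> (F i) + inverse (real (Suc j))) \<longlonglongrightarrow> c * \<nu> (F i)"
      using tendsto_add[OF tendsto_const LIMSEQ_inverse_real_of_nat] by simp
    have "s - \<Psi> \<nu> \<le> c * \<nu> (F i) + inverse (real (Suc j))" if "j \<ge> i" for j
      
    proof -
      have "s - 1 / real (Suc j) \<le> c * \<nu> (F i) + \<Psi> \<nu>"
        using \<nu>(2)[of j] that unfolding S_def by blast
      then show ?thesis by (simp add: divide_inverse)
    qed
    then show "\<exists>N. \<forall>j\<ge>N. s - \<Psi> \<nu> \<le> c * \<nu> (F i) + inverse (real (Suc j))" by blast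
  qed
  have "s - \<Psi> \<nu> \<le> c * \<phi> \<nu>"
    by (rule LIMSEQ_le_const[OF tendsto_mult[OF tendsto_const lim[OF \<nu>P]]]) (use s_le in blast)
  moreover have "c * \<phi> \<eta> + \<Psi> \<eta> \<le> s" if "\<eta> \<in> P" for \<eta>
    unfolding s_def by (rule cSUP_upper[OF that bdd])
  ultimately have max: "c * \<phi> \<eta> + \<Psi> \<eta> \<le> c * \<phi> \<nu> + \<Psi> \<nu>" if "\<eta> \<in> P" for \<eta>
    using that by force
  have pos: "\<epsilon> / 3 \<le> \<phi> \<nu>"
  proof -
    have "\<nu>0 \<in> P" using \<nu>0 by (simp add: P_def)
    have "\<epsilon> \<le> \<phi> \<nu>0" unfolding \<phi>_def by (rule cINF_greatest) (use \<nu>0 in auto)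
    then have "3 \<le> c * \<phi> \<nu>0" using \<nu>0(3) by (simp add: c_def field_simps)
    then have "1 \<le> c * \<phi> \<nu>" using max[OF \<open>\<nu>0 \<in> P\<close>] \<Psi>0[of \<nu>0] \<Psi>2[OF \<nu>Q] \<open>\<nu>0 \<in> P\<close> PQ by force
    then show ?thesis using \<nu>0(3) by (simp add: c_def field_simps)
  qed
  have "\<eta> = \<nu>" if \<eta>: "inv_fa_prob X \<eta>" and dom: "\<forall>A\<in>finitary_sets X. \<eta> A \<le> C' * \<nu> A" for \<eta> C'
  proof -
    \<comment> \<open>A larger constant dominates as well, and \<open>D > 1\<close> gives \<kappa> a
      positive weight.\<close>
    define D where "D = max C' 1 + 1"
    have D: "D > 1" "C' \<le> D" by (auto simp: D_def)
    have fa: "fa_prob X \<nu>" "fa_prob X \<eta>" using \<nu>(1) \<eta> by (auto simp: inv_fa_prob_def)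
    have \<eta>D: "\<eta> A \<le> D * \<nu> A" if "A \<in> finitary_sets X" for A
      using dom that mult_right_mono[OF D(2) fa_prob_bounds(1)[OF fa(1), of A]] by force
    define \<kappa> where "\<kappa> = (\<lambda>A. (D * \<nu> A - \<eta> A) / (D - 1))"
    have "inv_fa_prob X \<kappa>"
      unfolding \<kappa>_def by (rule inv_fa_prob_complement[OF \<nu>(1) \<eta> X D(1) \<eta>D])
    then have P: "\<eta> \<in> P" "\<kappa> \<in> P" and Q: "\<eta> \<in> Q" "\<kappa> \<in> Q" using \<eta> PQ by (auto simp: P_def)
    have eq: "D * \<nu> A = \<eta> A + (D - 1) * \<kappa> A" for A
      using D(1) by (simp add: \<kappa>_def)
    have \<phi>_eq: "D * \<phi> \<nu> = \<phi> \<eta> + (D - 1) * \<phi> \<kappa>"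
    proof (rule LIMSEQ_unique)
      show "(\<lambda>n. D * \<nu> (F n)) \<longlonglongrightarrow> D * \<phi> \<nu>" by (intro tendsto_intros lim[OF \<nu>P])
      show "(\<lambda>n. D * \<nu> (F n)) \<longlonglongrightarrow> \<phi> \<eta> + (D - 1) * \<phi> \<kappa>"
        unfolding eq by (intro tendsto_intros lim P)
    qed
    \<comment> \<open>The exact convexity defect of the square for the combination
      \<open>D \<nu> = \<eta> + (D - 1) \<kappa>\<close>, multiplied by
      \<open>D\<^sup>2\<close>.\<close>
    have sq: "D\<^sup>2 * (\<nu> A)\<^sup>2 = D * (\<eta> A)\<^sup>2 + D * (D - 1) * (\<kappa> A)\<^sup>2 - (D - 1) * (\<eta> A - \<kappa> A)\<^sup>2" for A
    proof -
      have "D\<^sup>2 * (\<nu> A)\<^sup>2 = (\<eta> A + (D - 1) * \<kappa> A)\<^sup>2" by (simp add: eq flip: power_mult_distrib)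
      then show ?thesis by (simp add: power2_eq_square algebra_simps)
    qed
    have term_eq: "(D - 1) * ((1/2)^j * (\<eta> (C j) - \<kappa> (C j))\<^sup>2) =
        D * ((1/2)^j * (\<eta> (C j))\<^sup>2) + D * (D - 1) * ((1/2)^j * (\<kappa> (C j))\<^sup>2) - D\<^sup>2 * ((1/2)^j * (\<nu> (C j))\<^sup>2)" for j
    proof -
      have "(D - 1) * (\<eta> (C j) - \<kappa> (C j))\<^sup>2 =
          D * (\<eta> (C j))\<^sup>2 + D * (D - 1) * (\<kappa> (C j))\<^sup>2 - D\<^sup>2 * (\<nu> (C j))\<^sup>2"
        using sq[of "C j"] by simp
      then have "(1/2)^j * ((D - 1) * (\<eta> (C j) - \<kappa> (C j))\<^sup>2) =
          (1/2)^j * (D * (\<eta> (C j))\<^sup>2 + D * (D - 1) * (\<kappa> (C j))\<^sup>2 - D\<^sup>2 * (\<nu> (C j))\<^sup>2)"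
        by (rule arg_cong)
      then show ?thesis by (simp only: ring_distribs mult_ac)
    qed
    have sums: "(\<lambda>j. (D - 1) * ((1/2)^j * (\<eta> (C j) - \<kappa> (C j))\<^sup>2)) sums
        (D * \<Psi> \<eta> + D * (D - 1) * \<Psi> \<kappa> - D\<^sup>2 * \<Psi> \<nu>)"
      unfolding term_eq \<Psi>_def
      by (intro sums_diff sums_add sums_mult summable_sums sm Q \<nu>Q)
    \<comment> \<open>Maximality is used at \<eta> with weight \<open>D\<close> and at \<kappa> with
      weight \<open>D * (D - 1)\<close>, which add up to \<open>D\<^sup>2\<close>. The affine part
      \<phi> cancels, so the total convexity defect of \<Psi>, a sum of nonnegative terms, is at
      most \<open>0\<close>.\<close>
    have "D * (c * \<phi> \<eta> + \<Psi> \<eta>) + D * (D - 1) * (c * \<phi> \<kappa> + \<Psi> \<kappa>) \<le>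
        D * (c * \<phi> \<nu> + \<Psi> \<nu>) + D * (D - 1) * (c * \<phi> \<nu> + \<Psi> \<nu>)"
      using D(1) by (intro add_mono[OF mult_left_mono[OF max[OF P(1)]] mult_left_mono[OF max[OF P(2)]]]) auto
    also have "\<dots> = D * c * (D * \<phi> \<nu>) + D\<^sup>2 * \<Psi> \<nu>"
      by (simp add: algebra_simps power2_eq_square)
    also have "\<dots> = D * c * (\<phi> \<eta> + (D - 1) * \<phi> \<kappa>) + D\<^sup>2 * \<Psi> \<nu>"
      by (simp only: \<phi>_eq)
    finally have "D * \<Psi> \<eta> + D * (D - 1) * \<Psi> \<kappa> - D\<^sup>2 * \<Psi> \<nu> \<le> 0"
      by (simp add: algebra_simps)
    then have le0: "(\<Sum>j. (D - 1) * ((1/2)^j * (\<eta> (C j) - \<kappa> (C j))\<^sup>2)) \<le> 0"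
      using sums_unique[OF sums] by simp
    then have "(D - 1) * ((1/2)^j * (\<eta> (C j) - \<kappa> (C j))\<^sup>2) = 0" for j
    proof -
      have nn: "0 \<le> (D - 1) * ((1/2)^j * (\<eta> (C j) - \<kappa> (C j))\<^sup>2)" for j
        using D(1) by simp
      have "(\<Sum>j. (D - 1) * ((1/2)^j * (\<eta> (C j) - \<kappa> (C j))\<^sup>2)) = 0"
        by (rule order_antisym[OF le0 suminf_nonneg[OF sums_summable[OF sums] nn]])
      then have "\<forall>j. (D - 1) * ((1/2)^j * (\<eta> (C j) - \<kappa> (C j))\<^sup>2) = 0"
        by (rule iffD1[OF suminf_eq_zero_iff[OF sums_summable[OF sums] nn]])
      then show ?thesis by blast
    qed
    then have *: "\<eta> (C j) = \<kappa> (C j)" for j using D(1) by simp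
    show "\<eta> = \<nu>"
    proof
      fix A show "\<eta> A = \<nu> A"
      proof (cases "A \<in> finitary_sets X")
        case True
        then have "A \<in> range C" by (simp only: range_C)
        then have "\<eta> A = \<kappa> A" using * by auto
        then have "D * \<eta> A = D * \<nu> A" using eq[of A] by (auto simp: algebra_simps)
        then show ?thesis using D(1) by simp
      next
        case False
        then show ?thesis using fa by (simp add: fa_prob_def)
      qed
    qed
  qed
  then have "extremal X \<nu>" using \<nu>(1) unfolding extremal_def by blast
  moreover have "\<epsilon> / 3 \<le> \<nu> (F n)" for n using pos \<phi>_le[OF \<nu>P, of n] by simp
  ultimately show thesis using that[of \<nu> "\<epsilon> / 3"] \<nu>0(3) by auto
qed

text \<open>Conditioning on an invariant set \<open>E\<close> of positive measure gives an invariant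
  measure dominated by \<open>\<nu> / prob E\<close>. By extremality it is the original measure,
  which is possible only if \<open>E\<close> has measure \<open>1\<close>.\<close>

lemma extremal_ergodic:
  fixes X :: "('i::{linordered_euclidean_semiring,countable} \<Rightarrow> 'a::{finite,discrete_topology}) set"
  assumes X: "closed X" "shift ` X \<subseteq> X" and "extremal X \<nu>"
  obtains \<mu> where "\<mu> \<in> ergodic_measures X" "\<And>A. A \<in> finitary_sets X \<Longrightarrow> measure \<mu> A = \<nu> A"
proof -
  have \<nu>: "inv_fa_prob X \<nu>" using assms(3) by (simp add: extremal_def)
  obtain \<mu> where \<mu>: "\<mu> \<in> invariant_measures X" "\<And>A. A \<in> finitary_sets X \<Longrightarrow> measure \<mu> A = \<nu> A"
    using inv_fa_prob_extends[OF X \<nu>] by metis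
  have P: "\<mu> \<in> prob_measures X" using \<mu>(1) by (simp add: invariant_measures_def)
  interpret prob_space \<mu> by (rule prob_measures_simps[OF P])
  note sp = prob_measures_simps(2)[OF P]
  have "prob E = 0 \<or> prob E = 1" if E: "E \<in> events" "shift -` E \<inter> space \<mu> = E" for E
  proof (cases "prob E = 0")
    case False
    have em: "emeasure \<mu> E \<noteq> 0" using False by (auto simp: measure_def)
    define \<mu>E where "\<mu>E = uniform_measure \<mu> E"
    have mE: "measure \<mu>E A = prob (E \<inter> A) / prob E" if "A \<in> events" for A
      unfolding \<mu>E_def using that em by (intro measure_uniform_measure) auto
    have PE: "\<mu>E \<in> prob_measures X"
      using P prob_space_uniform_measure[OF em] by (auto simp: prob_measures_def \<mu>E_def)
    have IE: "\<mu>E \<in> invariant_measures X"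
    proof (rule invariant_measuresI[OF X PE])
      fix A assume "A \<in> finitary_sets X"
      then have A: "A \<in> events" by (rule finitary_sets_measurable[OF X(1) P])
      have "shift -` A \<inter> X \<in> events"
        using measurable_sets[OF shift_measurable[OF X P] A] sp by simp
      then have "measure \<mu>E (shift -` A \<inter> X) = prob (E \<inter> (shift -` A \<inter> X)) / prob E" by (rule mE)
      \<comment> \<open>Invariance of \<open>E\<close> enters here: \<open>E\<close> may be replaced
        by its preimage, so that the whole intersection becomes a preimage.\<close>
      also have "E \<inter> (shift -` A \<inter> X) = shift -` (E \<inter> A) \<inter> space \<mu>"
        using E(2) sp by blast
      also have "prob \<dots> = prob (E \<inter> A)"
        using \<mu>(1) sets.Int[OF E(1) A] unfolding invariant_measures_def by blast
      also have "\<dots> / prob E = measure \<mu>E A" by (rule mE[OF A, symmetric])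
      finally show "measure \<mu>E (shift -` A \<inter> X) = measure \<mu>E A" .
    qed
    define \<eta> where "\<eta> = (\<lambda>A. if A \<in> finitary_sets X then measure \<mu>E A else 0)"
    have "inv_fa_prob X \<eta>" unfolding \<eta>_def by (rule inv_fa_prob_of_measure[OF X IE])
    moreover have "\<forall>A\<in>finitary_sets X. \<eta> A \<le> (1 / prob E) * \<nu> A"
    proof
      fix A assume A: "A \<in> finitary_sets X"
      have A': "A \<in> events" by (rule finitary_sets_measurable[OF X(1) P A])
      have "prob (E \<inter> A) \<le> \<nu> A"
        unfolding \<mu>(2)[OF A, symmetric] using A' by (intro finite_measure_mono) auto
      then show "\<eta> A \<le> (1 / prob E) * \<nu> A"
        using A mE[OF A'] by (simp add: \<eta>_def divide_right_mono)
    qed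
    ultimately have eq: "\<eta> = \<nu>" using assms(3) unfolding extremal_def by blast
    have "measure \<mu>E A = prob A" if "A \<in> finitary_sets X" for A
    proof -
      have "\<eta> A = measure \<mu>E A" using that by (simp add: \<eta>_def)
      then show ?thesis using \<mu>(2)[OF that] eq by simp
    qed
    then have "\<mu>E = \<mu>" by (rule prob_measures_eqI[OF X(1) PE P])
    then have "prob E = 1" using mE[OF E(1)] False by simp
    then show ?thesis by simp
  qed simp
  then have "\<mu> \<in> ergodic_measures X" using \<mu>(1) by (auto simp: ergodic_measures_def)
  then show thesis using that \<mu>(2) by blast
qed

section \<open>Visit frequencies along orbits\<close>

lemma funpow_shift_in: "shift ` X \<subseteq> X \<Longrightarrow> x \<in> X \<Longrightarrow> (shift ^^ i) x \<in> X"
  by (induction i) auto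

lemma funpow_shift_vimage_Suc:
  assumes "shift ` X \<subseteq> X"
  shows "(shift ^^ i) -` (shift -` A \<inter> X) \<inter> X = (shift ^^ Suc i) -` A \<inter> X"
    and "shift -` ((shift ^^ i) -` A \<inter> X) \<inter> X = (shift ^^ Suc i) -` A \<inter> X"
proof -
  have "(shift ^^ i) (shift x) = shift ((shift ^^ i) x)" for x :: "'a \<Rightarrow> 'b"
    by (simp add: funpow_swap1)
  then show "(shift ^^ i) -` (shift -` A \<inter> X) \<inter> X = (shift ^^ Suc i) -` A \<inter> X"
    and "shift -` ((shift ^^ i) -` A \<inter> X) \<inter> X = (shift ^^ Suc i) -` A \<inter> X"
    using assms funpow_shift_in[OF assms] by auto
qed

lemma funpow_shift_vimage_finitary:
  assumes "shift ` X \<subseteq> X" "A \<in> finitary_sets X"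
  shows "(shift ^^ i) -` A \<inter> X \<in> finitary_sets X"
proof (induction i)
  case 0
  have "A \<subseteq> X" using assms(2) by (auto simp: finitary_sets_def)
  then have "A \<inter> X = A" by blast
  then show ?case using assms(2) by simp
next
  case (Suc i)
  then show ?case
    using shift_vimage_finitary[OF assms(1) Suc] by (simp only: funpow_shift_vimage_Suc[OF assms(1)])
qed

lemma inv_fa_prob_funpow:
  assumes "shift ` X \<subseteq> X" "inv_fa_prob X \<nu>" "A \<in> finitary_sets X"
  shows "\<nu> ((shift ^^ i) -` A \<inter> X) = \<nu> A"
proof (induction i)
  case 0
  have "A \<subseteq> X" using assms(3) by (auto simp: finitary_sets_def)
  then have "A \<inter> X = A" by blast
  then show ?case by simp
next
  case (Suc i)
  have "\<nu> (shift -` ((shift ^^ i) -` A \<inter> X) \<inter> X) = \<nu> ((shift ^^ i) -` A \<inter> X)"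
    using assms(2) funpow_shift_vimage_finitary[OF assms(1,3)] unfolding inv_fa_prob_def by blast
  then show ?case using Suc by (simp only: funpow_shift_vimage_Suc[OF assms(1)])
qed

definition visits :: "('i::linordered_euclidean_semiring \<Rightarrow> 'a) set \<Rightarrow> nat \<Rightarrow> ('i \<Rightarrow> 'a) \<Rightarrow> real" where
  "visits A k x = (\<Sum>i<k. indicator A ((shift ^^ i) x))"

lemma visits_superlevel_finitary:
  assumes X: "shift ` X \<subseteq> X" and A: "A \<in> finitary_sets X"
  shows "{x\<in>X. c \<le> visits A k x} \<in> finitary_sets X"
proof -
  define G where "G i = (SOME F. finite F \<and>
    (\<forall>x\<in>X. \<forall>y\<in>X. (\<forall>j\<in>F. x j = y j) \<longrightarrow> (x \<in> (shift ^^ i) -` A \<inter> X \<longleftrightarrow> y \<in> (shift ^^ i) -` A \<inter> X)))" for i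
  have G: "finite (G i) \<and>
    (\<forall>x\<in>X. \<forall>y\<in>X. (\<forall>j\<in>G i. x j = y j) \<longrightarrow> (x \<in> (shift ^^ i) -` A \<inter> X \<longleftrightarrow> y \<in> (shift ^^ i) -` A \<inter> X))" for i
    unfolding G_def
  proof (rule someI_ex)
    show "\<exists>F. finite F \<and>
      (\<forall>x\<in>X. \<forall>y\<in>X. (\<forall>j\<in>F. x j = y j) \<longrightarrow> (x \<in> (shift ^^ i) -` A \<inter> X \<longleftrightarrow> y \<in> (shift ^^ i) -` A \<inter> X))"
      by (rule finitary_setsE[OF funpow_shift_vimage_finitary[OF X A, of i]]) (intro exI conjI)
  qed
  show ?thesis
  proof (rule finitary_setsI[of _ _ "\<Union>i<k. G i"])
    show "finite (\<Union>i<k. G i)" using G by blast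
    fix x y assume xy: "x \<in> X" "y \<in> X" "\<forall>j\<in>\<Union>i<k. G i. x j = y j" "x \<in> {x\<in>X. c \<le> visits A k x}"
    have "(shift ^^ i) x \<in> A \<longleftrightarrow> (shift ^^ i) y \<in> A" if "i < k" for i
    proof -
      have "\<forall>j\<in>G i. x j = y j" using xy(3) that by blast
      then have "x \<in> (shift ^^ i) -` A \<inter> X \<longleftrightarrow> y \<in> (shift ^^ i) -` A \<inter> X"
        using G xy(1,2) by blast
      then show ?thesis using xy(1,2) by simp
    qed
    then have "visits A k x = visits A k y"
      unfolding visits_def by (intro sum.cong) (auto simp: indicator_def)
    then show "y \<in> {x\<in>X. c \<le> visits A k x}" using xy by simp
  qed auto
qed

text \<open>If the visits were too frequent on sets of measure at least \<open>\<delta>\<close> for arbitrarily large \<open>k\<close>, then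
  averaging along the orbit the measure conditioned on these sets would yield, in the limit, an
  invariant content dominated by \<open>\<nu> / \<delta>\<close> and different from \<open>\<nu>\<close>.\<close>

lemma extremal_visits:
  fixes X :: "('i::{linordered_euclidean_semiring,countable} \<Rightarrow> 'a::{finite,discrete_topology}) set"
  assumes X: "closed X" "shift ` X \<subseteq> X" and ext: "extremal X \<nu>"
    and A: "A \<in> finitary_sets X" and r: "r > 0" and \<delta>: "\<delta> > 0"
  shows "\<forall>\<^sub>F k in sequentially. \<nu> {x\<in>X. real k * (\<nu> A + r) \<le> visits A k x} < \<delta>"
proof (rule ccontr)
  assume not: "\<not> ?thesis"
  interpret algebra X "finitary_sets X" by (rule algebra_finitary_sets)
  define T where "T i B = (shift ^^ i) -` B \<inter> X" for i B
  have TF: "T i B \<in> finitary_sets X" if "B \<in> finitary_sets X" for i B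
    unfolding T_def by (rule funpow_shift_vimage_finitary[OF X(2) that])
  have \<nu>: "inv_fa_prob X \<nu>" "fa_prob X \<nu>" using ext by (auto simp: extremal_def inv_fa_prob_def)
  have \<nu>T: "\<nu> (T i B) = \<nu> B" if "B \<in> finitary_sets X" for i B
    unfolding T_def by (rule inv_fa_prob_funpow[OF X(2) \<nu>(1) that])
  obtain \<mu> where \<mu>: "\<mu> \<in> invariant_measures X" "\<And>A. A \<in> finitary_sets X \<Longrightarrow> measure \<mu> A = \<nu> A"
    using inv_fa_prob_extends[OF X \<nu>(1)] by metis
  have P: "\<mu> \<in> prob_measures X" using \<mu>(1) by (simp add: invariant_measures_def)
  interpret \<mu>: prob_space \<mu> by (rule prob_measures_simps[OF P])
  note ms = finitary_sets_measurable[OF X(1) P]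
  \<comment> \<open>The same constraints for every \<open>j\<close>: domination by
    \<open>\<nu> / \<delta>\<close> and an excess of \<open>r\<close> at \<open>A\<close>. Only the
    invariance error improves with \<open>j\<close>.\<close>
  define S :: "nat \<Rightarrow> (('i \<Rightarrow> 'a) set \<Rightarrow> real) set"
    where "S = (\<lambda>j. {\<eta>. (\<forall>B\<in>finitary_sets X. \<eta> B \<le> \<nu> B / \<delta>) \<and> \<nu> A + r \<le> \<eta> A})"
  have "\<exists>\<eta>. inv_fa_prob X \<eta> \<and> (\<forall>j. \<eta> \<in> S j)"
  proof (rule inv_fa_prob_limit[of S X "1 / \<delta>"])
    show "closed (S j \<inter> {\<nu>. \<forall>A. 0 \<le> \<nu> A \<and> \<nu> A \<le> 1})" for j
      unfolding S_def Collect_conj_eq Collect_ball_eq Collect_all_eq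
      by (intro closed_Int closed_INT ballI closed_Collect_le continuous_intros
          continuous_on_product_coordinates)
    show "decseq S" by (simp add: S_def decseq_def)
    fix j
    obtain k where k: "k \<ge> Suc j" "\<not> \<nu> {x\<in>X. real k * (\<nu> A + r) \<le> visits A k x} < \<delta>"
      using not unfolding eventually_sequentially by blast
    define W where "W = {x\<in>X. real k * (\<nu> A + r) \<le> visits A k x}"
    have W: "W \<in> finitary_sets X" unfolding W_def by (rule visits_superlevel_finitary[OF X(2) A])
    have \<nu>W: "\<nu> W \<ge> \<delta>" using k(2) by (simp add: W_def)
    have kp: "real k > 0" "real k * \<nu> W > 0" "\<nu> W \<noteq> 0" using k(1) \<nu>W \<delta> by auto
    \<comment> \<open>The content \<nu> conditioned on \<open>W\<close>, transported by the
      \<open>i\<close>-fold shift and averaged over \<open>i < k\<close>.\<close>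
    define \<eta> where "\<eta> B = (if B \<in> finitary_sets X then (\<Sum>i<k. \<nu> (W \<inter> T i B)) / (real k * \<nu> W) else 0)" for B
    have WT: "W \<inter> T i B \<in> finitary_sets X" if "B \<in> finitary_sets X" for i B
      using W TF[OF that] by auto
    have "T i X = X" for i
      unfolding T_def using funpow_shift_in[OF X(2)] by auto
    moreover have "W \<inter> X = W" using W sets_into_space by blast
    ultimately have "\<eta> X = 1" using kp by (simp add: \<eta>_def)
    moreover have "\<eta> (B \<union> B') = \<eta> B + \<eta> B'"
      if "B \<in> finitary_sets X" "B' \<in> finitary_sets X" "B \<inter> B' = {}" for B B'
    proof -
      have "\<nu> (W \<inter> T i (B \<union> B')) = \<nu> (W \<inter> T i B) + \<nu> (W \<inter> T i B')" for i
      proof -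
        have "W \<inter> T i (B \<union> B') = (W \<inter> T i B) \<union> (W \<inter> T i B')" "(W \<inter> T i B) \<inter> (W \<inter> T i B') = {}"
          using that(3) by (auto simp: T_def)
        then show ?thesis using \<nu>(2) WT that(1,2) by (simp add: fa_prob_def)
      qed
      then show ?thesis using that by (simp add: \<eta>_def sum.distrib add_divide_distrib Un)
    qed
    moreover have "0 \<le> \<eta> B" for B
      using kp fa_prob_bounds[OF \<nu>(2)] by (auto simp: \<eta>_def intro!: divide_nonneg_pos sum_nonneg)
    moreover have "\<eta> B = 0" if "B \<in> - finitary_sets X" for B
      using that by (simp add: \<eta>_def)
    ultimately have "fa_prob X \<eta>"
      unfolding fa_prob_def by blast
    moreover have "\<bar>\<eta> (shift -` B \<inter> X) - \<eta> B\<bar> \<le> 1 / \<delta> / real (Suc j)" if B: "B \<in> finitary_sets X" for B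
    proof -
      have T_Suc: "T i (shift -` B \<inter> X) = T (Suc i) B" for i
        unfolding T_def by (rule funpow_shift_vimage_Suc(1)[OF X(2)])
      have "\<eta> (shift -` B \<inter> X) - \<eta> B = (\<Sum>i<k. \<nu> (W \<inter> T (Suc i) B) - \<nu> (W \<inter> T i B)) / (real k * \<nu> W)"
        using shift_vimage_finitary[OF X(2) B] B
        by (simp add: \<eta>_def T_Suc sum_subtractf diff_divide_distrib)
      \<comment> \<open>Telescoping leaves two values in \<open>[0, 1]\<close>; with
        \<open>k \<ge> j + 1\<close> and \<open>\<nu> W \<ge> \<delta>\<close> the error is at most
        \<open>1 / ((j + 1) \<delta>)\<close>, hence the constant
        \<open>1 / \<delta>\<close>.\<close>
      also have "\<dots> = (\<nu> (W \<inter> T k B) - \<nu> (W \<inter> T 0 B)) / (real k * \<nu> W)"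
        by (simp only: sum_lessThan_telescope[of "\<lambda>i. \<nu> (W \<inter> T i B)" k])
      also have "\<bar>\<dots>\<bar> \<le> 1 / (real k * \<nu> W)"
        using kp fa_prob_bounds[OF \<nu>(2), of "W \<inter> T k B"] fa_prob_bounds[OF \<nu>(2), of "W \<inter> T 0 B"]
        by (simp add: divide_right_mono)
      also have "\<dots> \<le> 1 / (real (Suc j) * \<delta>)"
        using k(1) \<nu>W \<delta> kp by (intro divide_left_mono mult_mono) auto
      finally show ?thesis by (simp add: mult.commute)
    qed
    moreover have "\<eta> B \<le> \<nu> B / \<delta>" if B: "B \<in> finitary_sets X" for B
    proof -
      have "(\<Sum>i<k. \<nu> (W \<inter> T i B)) \<le> (\<Sum>i<k. \<nu> B)"
      proof (rule sum_mono)
        fix i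
        have "\<nu> (W \<inter> T i B) \<le> \<nu> (T i B)"
          by (rule fa_prob_mono[OF \<nu>(2) WT[OF B] TF[OF B]]) auto
        then show "\<nu> (W \<inter> T i B) \<le> \<nu> B" by (simp add: \<nu>T[OF B])
      qed
      then have "(\<Sum>i<k. \<nu> (W \<inter> T i B)) \<le> real k * \<nu> B" by simp
      then have "(\<Sum>i<k. \<nu> (W \<inter> T i B)) / (real k * \<nu> W) \<le> real k * \<nu> B / (real k * \<nu> W)"
        by (rule divide_right_mono[OF _ less_imp_le[OF kp(2)]])
      then have "\<eta> B \<le> real k * \<nu> B / (real k * \<nu> W)"
        using B by (simp only: \<eta>_def if_True)
      also have "\<dots> = \<nu> B / \<nu> W" using kp by simp
      also have "\<dots> \<le> \<nu> B / \<delta>"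
        using \<nu>W \<delta> fa_prob_bounds[OF \<nu>(2)] by (intro divide_left_mono) auto
      finally show ?thesis .
    qed
    moreover have "\<nu> A + r \<le> \<eta> A"
    proof -
      \<comment> \<open>The inequality defining \<open>W\<close> holds at each of its points and is
        integrated over \<open>W\<close>, using the extension \<mu> of \<nu>.\<close>
      have "real k * (\<nu> A + r) * \<nu> W = (\<integral>x. real k * (\<nu> A + r) * indicator W x \<partial>\<mu>)"
        using \<mu>(2)[OF W] ms[OF W] by (simp add: \<mu>.emeasure_eq_measure)
      also have "\<dots> \<le> (\<integral>x. (\<Sum>i<k. indicator (W \<inter> T i A) x) \<partial>\<mu>)"
      proof (rule integral_mono)
        show "integrable \<mu> (\<lambda>x. real k * (\<nu> A + r) * indicator W x)"
          using ms[OF W] by (intro integrable_mult_right integrable_real_indicator) (auto simp: \<mu>.emeasure_eq_measure)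
        show "integrable \<mu> (\<lambda>x. \<Sum>i<k. indicator (W \<inter> T i A) x :: real)"
          using ms[OF WT[OF A]]
          by (intro Bochner_Integration.integrable_sum integrable_real_indicator) (auto simp: \<mu>.emeasure_eq_measure)
        fix x
        show "real k * (\<nu> A + r) * indicator W x \<le> (\<Sum>i<k. indicator (W \<inter> T i A) x)"
        proof (cases "x \<in> W")
          case True
          then have "(\<Sum>i<k. indicator (W \<inter> T i A) x) = visits A k x"
            unfolding visits_def by (intro sum.cong) (auto simp: indicator_def T_def W_def)
          then show ?thesis using True by (simp add: W_def)
        qed (auto intro: sum_nonneg)
      qed
      also have "\<dots> = (\<Sum>i<k. \<nu> (W \<inter> T i A))"
        using ms[OF WT[OF A]] \<mu>(2)[OF WT[OF A]]
        by (subst Bochner_Integration.integral_sum) (auto simp: \<mu>.emeasure_eq_measure)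
      finally have "(\<nu> A + r) * (real k * \<nu> W) \<le> (\<Sum>i<k. \<nu> (W \<inter> T i A))" by (simp add: mult_ac)
      then show ?thesis using A kp by (simp add: \<eta>_def pos_le_divide_eq)
    qed
    ultimately show "\<exists>\<eta>\<in>S j. fa_prob X \<eta> \<and>
      (\<forall>A\<in>finitary_sets X. \<bar>\<eta> (shift -` A \<inter> X) - \<eta> A\<bar> \<le> 1 / \<delta> / real (Suc j))"
      unfolding S_def by blast
  qed
  then obtain \<eta> where \<eta>: "inv_fa_prob X \<eta>" "\<eta> \<in> S 0" by blast
  then have "\<forall>B\<in>finitary_sets X. \<eta> B \<le> (1 / \<delta>) * \<nu> B" by (simp add: S_def)
  then have "\<eta> = \<nu>" using ext \<eta>(1) unfolding extremal_def by blast
  then show False using \<eta>(2) r by (simp add: S_def)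
qed

section \<open>From visit frequencies to the metric \<open>dstar\<close>\<close>

lemma funpow_shift: "(shift ^^ i) x = (\<lambda>j. x (j + of_nat i))"
  by (induction i) (auto simp: shift_def algebra_simps)

lemma length_window [simp]: "length (window x i k) = k"
  by (simp add: window_def)

lemma take_drop_window:
  "i + l \<le> k \<Longrightarrow> take l (drop i (window x 0 k)) = window ((shift ^^ i) x) 0 l"
  by (rule nth_equalityI) (auto simp: window_def funpow_shift algebra_simps)

text \<open>Visits are counted at all starting positions below \<open>k\<close>, occurrences in the
  window only where the word still fits. The two counts differ at most in the last
  \<open>length C\<close> positions.\<close>

lemma Fr_window_visits:
  assumes "x \<in> X" "shift ` X \<subseteq> X" "C \<noteq> []" "length C \<le> k"
  shows "\<bar>real k * Fr (window x 0 k) C - visits {y\<in>X. window y 0 (length C) = C} k x\<bar> \<le> real (length C)"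
proof -
  define l where "l = length C"
  define P where "P i \<longleftrightarrow> window ((shift ^^ i) x) 0 l = C" for i
  have k: "k > 0" and l: "l \<le> k" "l > 0" using assms(3,4) by (cases C; simp add: l_def)+
  have "{i \<in> {0..k - l}. take l (drop i (window x 0 k)) = C} = {i. i \<le> k - l \<and> P i}"
    using l by (auto simp: P_def take_drop_window)
  then have 1: "real k * Fr (window x 0 k) C = real (card {i. i \<le> k - l \<and> P i})"
    using k l by (simp add: Fr_def flip: l_def)
  have "visits {y\<in>X. window y 0 (length C) = C} k x = (\<Sum>i<k. if P i then 1 else 0)"
    unfolding visits_def using funpow_shift_in[OF assms(2,1)]
    by (intro sum.cong) (auto simp: P_def l_def)
  also have "\<dots> = real (card {i. i < k \<and> P i})"
    by (simp add: sum.If_cases Int_def)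
  finally have 2: "visits {y\<in>X. window y 0 (length C) = C} k x = real (card {i. i < k \<and> P i})" .
  have "card {i. i \<le> k - l \<and> P i} \<le> card {i. i < k \<and> P i}"
    using l by (intro card_mono) auto
  moreover have "card {i. i < k \<and> P i} \<le> card ({i. i \<le> k - l \<and> P i} \<union> {k-l..<k})"
    by (intro card_mono) auto
  moreover have "\<dots> \<le> card {i. i \<le> k - l \<and> P i} + card {k-l..<k}"
    by (rule card_Un_le)
  ultimately have "\<bar>real (card {i. i \<le> k - l \<and> P i}) - real (card {i. i < k \<and> P i})\<bar> \<le> real l"
    using l by simp
  then show ?thesis unfolding 1 2 by (simp only: l_def)
qed

lemma finite_words: "finite {C :: 'a::finite list. length C = n}"
  using finite_lists_length_eq[of "UNIV :: 'a set" n] by simp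

text \<open>Each starting position carries at most one word of the given length. Together with
  \<open>sum_cylinders\<close> this bounds the inner sums of \<open>dstar\<close> between a measure
  and a block by \<open>2\<close>.\<close>

lemma sum_Fr_le_1:
  fixes B :: "'a::finite list"
  shows "(\<Sum>C | length C = Suc l. Fr B C) \<le> 1"
proof (cases "Suc l \<le> length B")
  case True
  define I where "I C = {i \<in> {0..length B - Suc l}. take (Suc l) (drop i B) = C}" for C
  have "(\<Sum>C | length C = Suc l. card (I C)) = card (\<Union>C\<in>{C. length C = Suc l}. I C)"
    using finite_words by (subst card_UN_disjoint) (auto simp: I_def)
  also have "\<dots> \<le> card {0..length B - Suc l}"
    by (intro card_mono) (auto simp: I_def)
  also have "\<dots> \<le> length B" using True by simp
  finally have "real (\<Sum>C | length C = Suc l. card (I C)) \<le> real (length B)" by (simp only: of_nat_le_iff)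
  moreover have "(\<Sum>C | length C = Suc l. Fr B C) = real (\<Sum>C | length C = Suc l. card (I C)) / real (length B)"
    unfolding of_nat_sum sum_divide_distrib using True by (intro sum.cong) (auto simp: Fr_def I_def)
  ultimately show ?thesis using True by (simp add: divide_le_eq)
qed (simp add: Fr_def)

lemma cylinder_finitary: "{y\<in>X. window y i k \<in> R} \<in> finitary_sets X"
proof (rule finitary_setsI)
  show "finite ((\<lambda>j. i + of_nat j) ` {..<k})" by simp
  fix x y assume "x \<in> X" "y \<in> X" "\<forall>j\<in>(\<lambda>j. i + of_nat j) ` {..<k}. x j = y j" "x \<in> {y\<in>X. window y i k \<in> R}"
  moreover from this(3) have "window x i k = window y i k" by (simp add: window_def)
  ultimately show "y \<in> {y\<in>X. window y i k \<in> R}" by simp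
qed auto

lemma sum_cylinders:
  fixes X :: "('i::{linordered_euclidean_semiring,countable} \<Rightarrow> 'a::{finite,discrete_topology}) set"
  assumes "closed X" "\<mu> \<in> prob_measures X"
  shows "(\<Sum>C | length C = l. measure \<mu> {x\<in>X. window x 0 l = C}) = 1"
proof -
  interpret prob_space \<mu> by (rule prob_measures_simps[OF assms(2)])
  have *: "{x\<in>X. window x 0 l = C} \<in> events" for C
    using finitary_sets_measurable[OF assms cylinder_finitary[of X 0 l "{C}"]] by simp
  have "(\<Sum>C | length C = l. prob {x\<in>X. window x 0 l = C}) = prob (\<Union>C\<in>{C. length C = l}. {x\<in>X. window x 0 l = C})"
    using * by (intro finite_measure_finite_Union[symmetric] finite_words) (auto simp: disjoint_family_on_def)
  also have "(\<Union>C\<in>{C. length C = l}. {x\<in>X. window x 0 l = C}) = space \<mu>"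
    using prob_measures_simps(2)[OF assms(2)] by auto
  finally show ?thesis by (simp add: prob_space)
qed

text \<open>Lengths above \<open>l0\<close> contribute at most
  \<open>2 * (1/2) ^ l0 < r / 4\<close>, by the bound \<open>2\<close> on each inner sum; the
  \<open>M\<close> nonempty words of length at most \<open>l0\<close> contribute at most
  \<open>M * \<rho> \<le> r / 4\<close>. So finitely many frequencies control the distance.\<close>

lemma dstar_small:
  fixes X :: "('i::{linordered_euclidean_semiring,countable} \<Rightarrow> 'a::{finite,discrete_topology}) set"
  assumes X: "closed X" and \<mu>: "\<mu> \<in> prob_measures X" and r: "r > 0"
  obtains l0 \<rho> where "\<rho> > 0"
    "\<And>B. (\<And>C. C \<noteq> [] \<Longrightarrow> length C \<le> l0 \<Longrightarrow>
        \<bar>measure \<mu> {x\<in>X. window x 0 (length C) = C} - Fr B C\<bar> \<le> \<rho>) \<Longrightarrow>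
      dstar (Inr \<mu>) (Inl B) < r"
proof -
  obtain l0 where l0: "(1/2::real) ^ l0 < r / 8"
    using real_arch_pow_inv[of "r / 8" "1/2"] r by auto
  define M where "M = (\<Sum>l<l0. card {C :: 'a list. length C = Suc l})"
  define \<rho> where "\<rho> = r / (4 * (1 + real M))"
  have \<rho>: "\<rho> > 0" using r by (simp add: \<rho>_def add_pos_nonneg)
  have M\<rho>: "real M * \<rho> \<le> r / 4"
    using r by (simp add: \<rho>_def field_simps)
  show thesis
  proof (rule that[OF \<rho>, of l0])
    fix B :: "'a list"
    assume B: "\<And>C. C \<noteq> [] \<Longrightarrow> length C \<le> l0 \<Longrightarrow>
      \<bar>measure \<mu> {x\<in>X. window x 0 (length C) = C} - Fr B C\<bar> \<le> \<rho>"
    define p where "p C = measure \<mu> {x\<in>X. window x 0 (length C) = C}" for C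
    define g where "g l = (\<Sum>C | length C = Suc l. \<bar>p C - Fr B C\<bar>)" for l
    have ds: "dstar (Inr \<mu>) (Inl B) = (\<Sum>l. (1/2) ^ Suc l * g l)"
      by (simp add: dstar_def g_def p_def value_at_def prob_measures_simps(2)[OF \<mu>])
    have g0: "0 \<le> g l" for l by (simp add: g_def sum_nonneg)
    have g2: "g l \<le> 2" for l
    proof -
      have "g l \<le> (\<Sum>C | length C = Suc l. p C + Fr B C)"
        unfolding g_def
      proof (rule sum_mono)
        fix C show "\<bar>p C - Fr B C\<bar> \<le> p C + Fr B C"
          by (auto simp: p_def Fr_def abs_le_iff)
      qed
      also have "\<dots> = (\<Sum>C | length C = Suc l. p C) + (\<Sum>C | length C = Suc l. Fr B C)"
        by (rule sum.distrib)
      also have "(\<Sum>C | length C = Suc l. p C) = 1"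
        unfolding sum_cylinders[OF X \<mu>, of "Suc l", symmetric] by (intro sum.cong) (auto simp: p_def)
      finally show ?thesis using sum_Fr_le_1[where l = l and B = B] by simp
    qed
    have gs: "g l \<le> real (card {C :: 'a list. length C = Suc l}) * \<rho>" if "l < l0" for l
      unfolding g_def 
    proof (rule sum_bounded_above)
      fix C :: "'a list" assume "C \<in> {C. length C = Suc l}"
      then have "C \<noteq> []" "length C \<le> l0" using that by auto
      from B[OF this] show "\<bar>p C - Fr B C\<bar> \<le> \<rho>" by (simp only: p_def)
    qed
    have geom: "summable (\<lambda>l. (1/2::real) ^ l)" by (rule summable_geometric) simp
    have sm: "summable (\<lambda>l. (1/2) ^ Suc l * g l)"
    proof (rule summable_comparison_test'[OF geom])
      show "norm ((1/2) ^ Suc l * g l) \<le> (1/2) ^ l" for l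
        using g0[of l] g2[of l] by (simp add: abs_mult mult_left_le)
    qed
    have "(\<Sum>l. (1/2) ^ Suc l * g l) =
        (\<Sum>l. (1/2) ^ Suc (l + l0) * g (l + l0)) + (\<Sum>l<l0. (1/2) ^ Suc l * g l)"
      by (rule suminf_split_initial_segment[OF sm])
    also have "(\<Sum>l<l0. (1/2) ^ Suc l * g l) \<le> (\<Sum>l<l0. real (card {C :: 'a list. length C = Suc l}) * \<rho>)"
    proof (rule sum_mono)
      fix l assume "l \<in> {..<l0}"
      have "(1/2::real) ^ Suc l * g l \<le> 1 * g l"
        using g0 by (intro mult_right_mono power_le_one) auto
      then show "(1/2::real) ^ Suc l * g l \<le> real (card {C :: 'a list. length C = Suc l}) * \<rho>"
        using gs[of l] \<open>l \<in> {..<l0}\<close> by simp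
    qed
    also have "\<dots> = real M * \<rho>" by (simp add: M_def sum_distrib_right)
    also have "(\<Sum>l. (1/2) ^ Suc (l + l0) * g (l + l0)) \<le> (\<Sum>l. (1/2) ^ l0 * (1/2) ^ l)"
    proof (rule suminf_le)
      show "(1/2) ^ Suc (l + l0) * g (l + l0) \<le> (1/2) ^ l0 * (1/2) ^ l" for l
        using g2[of "l + l0"] by (simp add: power_add field_simps)
      show "summable (\<lambda>l. (1/2) ^ Suc (l + l0) * g (l + l0))"
        using sm by (rule summable_ignore_initial_segment)
      show "summable (\<lambda>l. (1/2::real) ^ l0 * (1/2) ^ l)" by (intro summable_mult geom)
    qed
    also have "\<dots> = 2 * (1/2) ^ l0"
      using suminf_geometric[of "1/2::real"] by (simp add: suminf_mult geom)
    finally show "dstar (Inr \<mu>) (Inl B) < r"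
      using ds l0 M\<rho> r by simp
  qed
qed

lemma extremal_windows_good:
  fixes X :: "('i::{linordered_euclidean_semiring,countable} \<Rightarrow> 'a::{finite,discrete_topology}) set"
  assumes X: "closed X" "shift ` X \<subseteq> X" and ext: "extremal X \<nu>"
    and U: "dstar_open X U" "Inr ` ergodic_measures X \<subseteq> U" and \<delta>: "\<delta> > 0"
  shows "\<forall>\<^sub>F k in sequentially. \<nu> {x\<in>X. Inl (window x 0 k) \<notin> U} < \<delta>"
proof -
  interpret algebra X "finitary_sets X" by (rule algebra_finitary_sets)
  obtain \<mu> where \<mu>: "\<mu> \<in> ergodic_measures X" "\<And>A. A \<in> finitary_sets X \<Longrightarrow> measure \<mu> A = \<nu> A"
    using extremal_ergodic[OF X ext] by metis
  have P: "\<mu> \<in> prob_measures X" using \<mu>(1) by (simp add: ergodic_measures_def invariant_measures_def)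
  interpret \<mu>: prob_space \<mu> by (rule prob_measures_simps[OF P])
  note ms = finitary_sets_measurable[OF X(1) P]
  have "Inr \<mu> \<in> U" using U(2) \<mu>(1) by blast
  then obtain r where r: "r > 0" "\<And>q. q \<in> blocks X <+> prob_measures X \<Longrightarrow> dstar (Inr \<mu>) q < r \<Longrightarrow> q \<in> U"
  proof -
    have "\<forall>p\<in>U. \<exists>r>0. \<forall>q \<in> blocks X <+> prob_measures X. dstar p q < r \<longrightarrow> q \<in> U"
      using U(1) unfolding dstar_open_def by blast
    from bspec[OF this \<open>Inr \<mu> \<in> U\<close>] show ?thesis using that by blast
  qed
  obtain l0 \<rho> where \<rho>: "\<rho> > 0" and ds: "\<And>B. (\<And>C. C \<noteq> [] \<Longrightarrow> length C \<le> l0 \<Longrightarrow>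
        \<bar>measure \<mu> {x\<in>X. window x 0 (length C) = C} - Fr B C\<bar> \<le> \<rho>) \<Longrightarrow> dstar (Inr \<mu>) (Inl B) < r"
    by (rule dstar_small[OF X(1) P r(1)]) blast
  define cyl where "cyl C = {x\<in>X. window x 0 (length C) = C}" for C :: "'a list"
  have cyl: "cyl C \<in> finitary_sets X" for C
    using cylinder_finitary[of X 0 "length C" "{C}"] by (simp add: cyl_def)
  \<comment> \<open>\<open>extremal_visits\<close> bounds visits only from above; for the complement
    of a cylinder it yields the lower bound for the cylinder.\<close>
  define \<A> where "\<A> = cyl ` {C. length C \<le> l0} \<union> (\<lambda>C. X - cyl C) ` {C. length C \<le> l0}"
  have \<A>: "finite \<A>" "\<A> \<subseteq> finitary_sets X"
    using cyl finite_lists_length_le[of "UNIV :: 'a set" l0] by (auto simp: \<A>_def)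
  \<comment> \<open>One half of \<rho> is spent on the deviation of the visits from \<nu>, the other
    half on the difference between visits and \<open>Fr\<close>, which is at most
    \<open>l0 / k\<close>.\<close>
  define W where "W k A = {x\<in>X. real k * (\<nu> A + \<rho> / 2) \<le> visits A k x}" for k A
  have W: "W k A \<in> finitary_sets X" if "A \<in> \<A>" for k A
    unfolding W_def using \<A>(2) that by (intro visits_superlevel_finitary X) auto
  \<comment> \<open>Prepares a union bound over \<A>; the added \<open>1\<close> keeps the
    denominator positive and the final inequality strict.\<close>
  define \<delta>' where "\<delta>' = \<delta> / (1 + real (card \<A>))"
  have \<delta>': "\<delta>' > 0" "real (card \<A>) * \<delta>' < \<delta>" using \<delta> by (auto simp: \<delta>'_def field_simps add_pos_nonneg)
  have "\<forall>\<^sub>F k in sequentially. \<forall>A\<in>\<A>. \<nu> (W k A) < \<delta>'"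
    unfolding W_def using \<A> \<rho> \<delta>' by (intro eventually_ball_finite extremal_visits[OF X ext] ballI) auto
  moreover have "\<forall>\<^sub>F k in sequentially. real l0 \<le> real k * (\<rho> / 2) \<and> max 1 l0 \<le> k"
  proof -
    obtain N :: nat where N: "real l0 / (\<rho> / 2) < real N" using reals_Archimedean2 by blast
    have "real l0 \<le> real k * (\<rho> / 2)" if "k \<ge> N" for k
    proof -
      have "real l0 / (\<rho> / 2) \<le> real k" using N that by linarith
      then show ?thesis using \<rho> by (simp add: field_simps)
    qed
    then show ?thesis
      using eventually_ge_at_top[of "max N (max 1 l0)"] by (auto elim!: eventually_mono)
  qed
  ultimately show ?thesis
  proof eventually_elim
    case (elim k)
    have sub: "{x\<in>X. Inl (window x 0 k) \<notin> U} \<subseteq> (\<Union>A\<in>\<A>. W k A)"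
    proof (rule ccontr)
      assume "\<not> ?thesis"
      then obtain x where x: "x \<in> X" "Inl (window x 0 k) \<notin> U" "\<And>A. A \<in> \<A> \<Longrightarrow> x \<notin> W k A" by auto
      have "dstar (Inr \<mu>) (Inl (window x 0 k)) < r"
      proof (rule ds)
        fix C :: "'a list" assume C: "C \<noteq> []" "length C \<le> l0"
        have k: "real k > 0" using elim by simp
        have "visits (cyl C) k x < real k * (\<nu> (cyl C) + \<rho> / 2)"
          using x(3)[of "cyl C"] x(1) C(2) by (auto simp: W_def \<A>_def)
        moreover have "visits (X - cyl C) k x < real k * (\<nu> (X - cyl C) + \<rho> / 2)"
          using x(3)[of "X - cyl C"] x(1) C(2) by (auto simp: W_def \<A>_def)
        moreover have "visits (X - cyl C) k x = real k - visits (cyl C) k x"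
        proof -
          have "visits (X - cyl C) k x = (\<Sum>i<k. 1 - indicator (cyl C) ((shift ^^ i) x))"
            unfolding visits_def using funpow_shift_in[OF X(2) x(1)] by (intro sum.cong) (auto simp: indicator_def)
          then show ?thesis by (simp add: visits_def sum_subtractf)
        qed
        moreover have "\<nu> (X - cyl C) = 1 - \<nu> (cyl C)"
        proof -
          have "prob_space.prob \<mu> (space \<mu> - cyl C) = 1 - prob_space.prob \<mu> (cyl C)"
            by (rule \<mu>.prob_compl[OF ms[OF cyl]])
          moreover have "X - cyl C \<in> finitary_sets X" using cyl[of C] by blast
          ultimately show ?thesis using \<mu>(2) cyl[of C] by (simp add: prob_measures_simps(2)[OF P])
        qed
        moreover have "\<bar>real k * Fr (window x 0 k) C - visits (cyl C) k x\<bar> \<le> real (length C)"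
          unfolding cyl_def using C elim by (intro Fr_window_visits[OF x(1) X(2)]) auto
        moreover have "real (length C) \<le> real k * (\<rho> / 2)" using C(2) elim by linarith
        ultimately have "\<bar>real k * \<nu> (cyl C) - real k * Fr (window x 0 k) C\<bar> \<le> real k * \<rho>"
          by (simp add: algebra_simps abs_le_iff)
        then have "real k * \<bar>\<nu> (cyl C) - Fr (window x 0 k) C\<bar> \<le> real k * \<rho>"
          using k by (simp add: abs_mult flip: right_diff_distrib)
        then have "\<bar>\<nu> (cyl C) - Fr (window x 0 k) C\<bar> \<le> \<rho>" using k by simp
        then show "\<bar>measure \<mu> {x\<in>X. window x 0 (length C) = C} - Fr (window x 0 k) C\<bar> \<le> \<rho>"
          using \<mu>(2)[OF cyl[of C]] by (simp add: cyl_def)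
      qed
      moreover have "window x 0 k \<in> blocks X" using x(1) elim by (auto simp: blocks_def)
      ultimately have "Inl (window x 0 k) \<in> U" using r(2) by blast
      then show False using x(2) by simp
    qed
    have bad: "{x\<in>X. Inl (window x 0 k) \<notin> U} \<in> finitary_sets X"
      using cylinder_finitary[of X 0 k "{B. Inl B \<notin> U}"] by simp
    have "\<nu> {x\<in>X. Inl (window x 0 k) \<notin> U} = measure \<mu> {x\<in>X. Inl (window x 0 k) \<notin> U}"
      by (rule \<mu>(2)[OF bad, symmetric])
    also have "\<dots> \<le> measure \<mu> (\<Union>A\<in>\<A>. W k A)"
      using sub \<A>(1) ms[OF W] by (intro \<mu>.finite_measure_mono) auto
    also have "\<dots> \<le> (\<Sum>A\<in>\<A>. measure \<mu> (W k A))"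
      using \<A>(1) ms[OF W] by (intro \<mu>.finite_measure_subadditive_finite) auto
    also have "\<dots> \<le> (\<Sum>A\<in>\<A>. \<delta>')"
      using elim W \<mu>(2) by (intro sum_mono) (auto intro: less_imp_le)
    also have "\<dots> < \<delta>" using \<delta>'(2) by simp
    finally show ?case .
  qed
qed

section \<open>Packings by good blocks\<close>

definition separated :: "('i::linorder \<times> 'i) set \<Rightarrow> bool" where
  "separated T \<longleftrightarrow> (\<forall>I\<in>T. fst I < snd I) \<and> (\<forall>I\<in>T. \<forall>J\<in>T. I = J \<or> snd I \<le> fst J \<or> snd J \<le> fst I)"

definition covered :: "('i::linorder \<times> 'i) set \<Rightarrow> 'i set" where
  "covered T = (\<Union>I\<in>T. {fst I..<snd I})"

text \<open>From the current position jump to the interval with the least start not before it, and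
  continue from its end. Even cut points are these ends, beginning with \<open>0\<close>, and odd
  ones the next starts, so gaps and intervals alternate. The growth \<open>k \<le> c (2 * k)\<close>
  will show that the pieces exhaust the half-line.\<close>

lemma enumerate_intervals:
  fixes T :: "(nat \<times> nat) set"
  assumes sep: "separated T" and unb: "\<And>p. \<exists>I\<in>T. p \<le> fst I"
  obtains c :: "nat \<Rightarrow> nat" where "mono c" "c 0 = 0" "\<And>k. k \<le> c (2 * k)"
    "\<And>k. (c (2 * k + 1), c (2 * k + 2)) \<in> T"
    "\<And>k. {c (2 * k)..<c (2 * k + 1)} \<inter> covered T = {}"
proof -
  define nxt where "nxt p = (ARG_MIN fst I. I \<in> T \<and> p \<le> fst I)" for p
  have nxt: "nxt p \<in> T" "p \<le> fst (nxt p)" for p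
  proof -
    obtain I where "I \<in> T \<and> p \<le> fst I" using unb by blast
    then have "nxt p \<in> T \<and> p \<le> fst (nxt p)" unfolding nxt_def by (rule arg_min_natI)
    then show "nxt p \<in> T" "p \<le> fst (nxt p)" by auto
  qed
  have nxt_le: "fst (nxt p) \<le> fst I" if "I \<in> T" "p \<le> fst I" for p I
    unfolding nxt_def by (rule arg_min_nat_le) (use that in simp)
  have lt: "fst I < snd I" if "I \<in> T" for I using sep that by (simp add: separated_def)
  define d where "d = rec_nat 0 (\<lambda>_ p. snd (nxt p))"
  have d: "d 0 = 0" "d (Suc k) = snd (nxt (d k))" for k by (simp_all add: d_def)
  define c where "c k = (if even k then d (k div 2) else fst (nxt (d (k div 2))))" for k
  have c_even: "c (2 * k) = d k" and c_odd: "c (2 * k + 1) = fst (nxt (d k))" for k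
    by (simp_all add: c_def)
  have c_Suc: "c (2 * k + 2) = snd (nxt (d k))" for k
    using c_even[of "Suc k"] by (simp add: d)
  \<comment> \<open>No interval is skipped: one that starts before the current position is already
    over, being either the interval chosen last or disjoint from it and to its left.\<close>
  have d_end: "snd I \<le> d k" if "I \<in> T" "fst I < d k" for I k
  proof (cases k)
    case (Suc k')
    have "I = nxt (d k') \<or> snd I \<le> fst (nxt (d k')) \<or> snd (nxt (d k')) \<le> fst I"
      using sep that(1) nxt(1) unfolding separated_def by blast
    then show ?thesis
      using that(2) lt[OF nxt(1), of "d k'"] unfolding Suc d by auto
  qed (use that in \<open>simp add: d\<close>)
  show thesis
  proof (rule that)
    show "mono c"
      unfolding mono_iff_le_Suc
    proof
      fix k show "c k \<le> c (Suc k)"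
      proof (cases "even k")
        case True
        then obtain l where "k = 2 * l" by blast
        then show ?thesis using c_even[of l] c_odd[of l] nxt(2)[of "d l"] by simp
      next
        case False
        then obtain l where "k = 2 * l + 1" using oddE by blast
        then show ?thesis using c_Suc[of l] c_odd[of l] lt[OF nxt(1), of "d l"] by simp
      qed
    qed
    show "c 0 = 0" using c_even[of 0] by (simp add: d)
    show "k \<le> c (2 * k)" for k
      unfolding c_even
    proof (induction k)
      case (Suc k)
      then show ?case using nxt(2)[of "d k"] lt[OF nxt(1), of "d k"] by (simp add: d)
    qed simp
    show "(c (2 * k + 1), c (2 * k + 2)) \<in> T" for k
      unfolding c_odd c_Suc using nxt(1) by simp
    show "{c (2 * k)..<c (2 * k + 1)} \<inter> covered T = {}" for k
    proof (rule equals0I)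
      fix t assume "t \<in> {c (2 * k)..<c (2 * k + 1)} \<inter> covered T"
      then obtain I where I: "I \<in> T" "fst I \<le> t" "t < snd I" "d k \<le> t" "t < fst (nxt (d k))"
        by (auto simp: covered_def c_even c_odd[simplified])
      then show False
        using d_end[OF I(1), of k] nxt_le[OF I(1), of "d k"] by linarith
    qed
  qed
qed

text \<open>The packing of cell \<open>j\<close> is translated by \<open>j * L\<close>. Intervals of
  different cells stay apart because each ends within its cell, and since no packing is empty there
  are intervals arbitrarily far out.\<close>

lemma concat_packings:
  fixes T :: "nat \<Rightarrow> (nat \<times> nat) set"
  assumes L: "L > 0" and sep: "\<And>j. separated (T j)" and le: "\<And>j. \<forall>I\<in>T j. snd I \<le> L"
    and ne: "\<And>j. T j \<noteq> {}"
  obtains c :: "nat \<Rightarrow> nat" where "mono c" "c 0 = 0" "\<And>k. k \<le> c (2 * k)"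
    "\<And>k. \<exists>j. \<exists>I\<in>T j. c (2 * k + 1) = j * L + fst I \<and> c (2 * k + 2) = j * L + snd I"
    "\<And>k j t. c (2 * k) \<le> j * L + t \<Longrightarrow> j * L + t < c (2 * k + 1) \<Longrightarrow> t \<notin> covered (T j)"
proof -
  define R where "R = (\<Union>j. (\<lambda>I. (j * L + fst I, j * L + snd I)) ` T j)"
  have lt: "fst I < snd I" if "I \<in> T j" for I j using sep[of j] that by (simp add: separated_def)
  have cells: "j * L + snd I \<le> j' * L + fst I'" if "j < j'" "I \<in> T j" for j j' and I I' :: "nat \<times> nat"
  proof -
    have "Suc j * L \<le> j' * L" using that(1) by (intro mult_le_mono1) simp
    then show ?thesis using bspec[OF le that(2)] by simp
  qed
  have "separated R"
    unfolding separated_def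
  proof (intro conjI ballI)
    fix I assume "I \<in> R" then show "fst I < snd I" using lt by (auto simp: R_def)
  next
    fix I J assume "I \<in> R" "J \<in> R"
    then obtain i j I' J' where IJ: "I' \<in> T i" "I = (i * L + fst I', i * L + snd I')"
      "J' \<in> T j" "J = (j * L + fst J', j * L + snd J')"
      by (auto simp: R_def)
    consider "i < j" | "j < i" | "i = j" by linarith
    then show "I = J \<or> snd I \<le> fst J \<or> snd J \<le> fst I"
    proof cases
      case 3
      then have "I' = J' \<or> snd I' \<le> fst J' \<or> snd J' \<le> fst I'"
        using sep[of j] IJ(1,3) unfolding separated_def by blast
      then show ?thesis using 3 IJ(2,4) by auto
    qed (use cells IJ in auto)
  qed
  moreover have "\<exists>I\<in>R. p \<le> fst I" for p
  proof -
    obtain I where "I \<in> T p" using ne by blast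
    then have "(p * L + fst I, p * L + snd I) \<in> R" unfolding R_def by blast
    moreover have "p \<le> p * L + fst I" using L by (simp add: trans_le_add1)
    ultimately show ?thesis by force
  qed
  ultimately obtain c where c: "mono c" "c 0 = 0" "\<And>k. k \<le> c (2 * k)"
    "\<And>k. (c (2 * k + 1), c (2 * k + 2)) \<in> R"
    "\<And>k. {c (2 * k)..<c (2 * k + 1)} \<inter> covered R = {}"
    by (rule enumerate_intervals) blast
  show thesis
  proof (rule that[OF c(1-3)])
    show "\<exists>j. \<exists>I\<in>T j. c (2 * k + 1) = j * L + fst I \<and> c (2 * k + 2) = j * L + snd I" for k
      using c(4)[of k] unfolding R_def by auto
    show "t \<notin> covered (T j)" if "c (2 * k) \<le> j * L + t" "j * L + t < c (2 * k + 1)" for k j t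
    proof
      assume "t \<in> covered (T j)"
      then obtain I where "I \<in> T j" "fst I \<le> t" "t < snd I" by (auto simp: covered_def)
      then have "j * L + t \<in> covered R" unfolding covered_def R_def by fastforce
      then show False using c(5)[of k] that by auto
    qed
  qed
qed

text \<open>One length \<open>N\<close> suffices, the density being an infimum over lengths. The
  first two assumptions hold for \<open>int\<close> and for \<open>nat\<close>; they bound the
  quotients by \<open>1\<close>, so that the real suprema are meaningful.\<close>

lemma upper_Banach_density_less:
  fixes A :: "'i::linordered_euclidean_semiring set"
  assumes "\<And>i n. finite {i..<i + of_nat n :: 'i}" "\<And>i n. card {i..<i + of_nat n :: 'i} = n"
    and "N > 0" "\<And>i. real (card (A \<inter> {i..<i + of_nat N})) \<le> b * real N" "b < \<epsilon>"
  shows "upper_Banach_density A < \<epsilon>"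
proof -
  define f where "f n i = real (card (A \<inter> {i..<i + of_nat n})) / real n" for n :: nat and i
  have f1: "f n i \<le> 1" for n i
  proof -
    have "card (A \<inter> {i..<i + of_nat n}) \<le> card {i..<i + of_nat n}"
      by (intro card_mono assms(1)) auto
    then show ?thesis by (cases "n = 0") (simp_all add: f_def assms(2))
  qed
  have "0 \<le> (SUP i. f n i)" for n
  proof -
    have "0 \<le> f n 0" by (simp add: f_def)
    also have "\<dots> \<le> (SUP i. f n i)" by (rule cSUP_upper) (auto intro: bdd_aboveI2 f1)
    finally show ?thesis .
  qed
  then have "upper_Banach_density A \<le> (SUP i. f N i)"
    unfolding upper_Banach_density_def f_def[symmetric] using assms(3)
    by (intro cINF_lower bdd_belowI2) auto
  also have "\<dots> \<le> b"
    using assms(3,4) by (intro cSUP_least) (auto simp: f_def divide_le_eq)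
  finally show ?thesis using assms(5) by simp
qed

lemma two_cells:
  fixes A cell0 cell1 :: "'b set"
  assumes "A \<inter> I \<subseteq> (A \<inter> cell0) \<union> (A \<inter> cell1)" "finite cell0" "finite cell1"
    "real (card (A \<inter> cell0)) \<le> b" "real (card (A \<inter> cell1)) \<le> b"
  shows "real (card (A \<inter> I)) \<le> 2 * b"
proof -
  have "card (A \<inter> I) \<le> card ((A \<inter> cell0) \<union> (A \<inter> cell1))"
    using assms by (intro card_mono) auto
  also have "\<dots> \<le> card (A \<inter> cell0) + card (A \<inter> cell1)" by (rule card_Un_le)
  finally show ?thesis using assms by linarith
qed

lemma bad_set_finitary:
  "{x\<in>X. \<forall>k. m \<le> k \<and> k \<le> n \<longrightarrow> Inl (window x 0 k) \<notin> U} \<in> finitary_sets X"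
proof (rule finitary_setsI)
  show "finite (of_nat ` {..<n} :: 'a set)" by simp
  fix x y :: "'a \<Rightarrow> 'b"
  assume *: "x \<in> X" "y \<in> X" "\<forall>i\<in>of_nat ` {..<n}. x i = y i"
    "x \<in> {x\<in>X. \<forall>k. m \<le> k \<and> k \<le> n \<longrightarrow> Inl (window x 0 k) \<notin> U}"
  have "window x 0 k = window y 0 k" if "k \<le> n" for k
    using *(3) that by (simp add: window_def)
  then show "y \<in> {x\<in>X. \<forall>k. m \<le> k \<and> k \<le> n \<longrightarrow> Inl (window x 0 k) \<notin> U}"
    using *(2,4) by auto
qed auto

text \<open>The passage from extremal to arbitrary invariant contents. For \<open>k \<ge> m\<close>
  the set \<open>F k\<close> lies in the set where the window of the single length \<open>k\<close>
  is bad, which is small for an extremal content.\<close>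

lemma bad_measure_small:
  fixes X :: "('i::{linordered_euclidean_semiring,countable} \<Rightarrow> 'a::{finite,discrete_topology}) set"
  assumes X: "closed X" "shift ` X \<subseteq> X"
    and U: "dstar_open X U" "Inr ` ergodic_measures X \<subseteq> U"
    and \<nu>: "inv_fa_prob X \<nu>" and \<epsilon>: "\<epsilon> > 0"
  shows "\<exists>n. \<nu> {x\<in>X. \<forall>k. m \<le> k \<and> k \<le> n \<longrightarrow> Inl (window x 0 k) \<notin> U} < \<epsilon>"
proof (rule ccontr)
  define F where "F n = {x\<in>X. \<forall>k. m \<le> k \<and> k \<le> n \<longrightarrow> Inl (window x 0 k) \<notin> U}" for n
  assume "\<not> ?thesis"
  then have *: "\<epsilon> \<le> \<nu> (F n)" for n by (auto simp: F_def not_less)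
  have F: "F n \<in> finitary_sets X" for n
    unfolding F_def by (rule bad_set_finitary)
  have dec: "decseq F" by (auto simp: decseq_def F_def)
  obtain \<nu>' \<delta> where \<nu>': "extremal X \<nu>'" "\<delta> > 0" "\<And>n. \<delta> \<le> \<nu>' (F n)"
    by (rule exists_extremal[OF X(2) F dec \<nu> * \<epsilon>]) blast
  have "\<forall>\<^sub>F k in sequentially. \<nu>' {x\<in>X. Inl (window x 0 k) \<notin> U} < \<delta> \<and> m \<le> k"
    by (intro eventually_conj extremal_windows_good[OF X \<nu>'(1) U \<nu>'(2)] eventually_ge_at_top)
  then obtain k where k: "\<nu>' {x\<in>X. Inl (window x 0 k) \<notin> U} < \<delta>" "m \<le> k"
    using eventually_happens'[OF sequentially_bot] by blast
  have "\<nu>' (F k) \<le> \<nu>' {x\<in>X. Inl (window x 0 k) \<notin> U}"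
  proof (rule fa_prob_mono[OF _ F])
    show "fa_prob X \<nu>'" using \<nu>'(1) by (simp add: extremal_def inv_fa_prob_def)
    show "{x\<in>X. Inl (window x 0 k) \<notin> U} \<in> finitary_sets X"
      using cylinder_finitary[of X 0 k "{B. Inl B \<notin> U}"] by simp
    show "F k \<subseteq> {x\<in>X. Inl (window x 0 k) \<notin> U}" using k(2) by (auto simp: F_def)
  qed
  then show False using \<nu>'(3)[of k] k(1) by simp
qed

text \<open>Scan from the left: take a good block of length at most \<open>n\<close> if one starts
  here, otherwise move on by one. Stopping once at most \<open>n\<close> positions remain ensures
  that every chosen block ends within \<open>L\<close>.\<close>

lemma greedy_packing:
  fixes G :: "nat \<Rightarrow> nat \<Rightarrow> bool"
  assumes pos: "\<forall>a k. G a k \<longrightarrow> k > 0"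
  shows "s \<le> L \<Longrightarrow> \<exists>T. separated T \<and>
    (\<forall>I\<in>T. s \<le> fst I \<and> snd I \<le> L \<and> G (fst I) (snd I - fst I)) \<and>
    (\<forall>t. s \<le> t \<and> t < L \<and> t \<notin> covered T \<longrightarrow> (\<forall>k\<le>n. \<not> G t k) \<or> L \<le> t + n)"
proof (induction "L - s" arbitrary: s rule: less_induct)
  case less
  show ?case
  proof (cases "L \<le> s + n")
    case True
    then show ?thesis by (intro exI[of _ "{}"]) (auto simp: separated_def)
  next
    case not_end: False
    show ?thesis
    proof (cases "\<exists>k\<le>n. G s k")
      case True
      then obtain k where k: "k \<le> n" "G s k" by blast
      have "k > 0" using pos k(2) by blast
      then have "L - (s + k) < L - s" "s + k \<le> L" using k(1) not_end by auto
      then obtain T where T: "separated T"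
        "\<forall>I\<in>T. s + k \<le> fst I \<and> snd I \<le> L \<and> G (fst I) (snd I - fst I)"
        "\<forall>t. s + k \<le> t \<and> t < L \<and> t \<notin> covered T \<longrightarrow> (\<forall>k\<le>n. \<not> G t k) \<or> L \<le> t + n"
        using less(1) by metis
      have "separated (insert (s, s + k) T)"
        using T(1,2) pos k(2) by (fastforce simp: separated_def)
      moreover have "covered (insert (s, s + k) T) = {s..<s + k} \<union> covered T"
        by (auto simp: covered_def)
      moreover have "\<forall>I\<in>insert (s, s + k) T. s \<le> fst I \<and> snd I \<le> L \<and> G (fst I) (snd I - fst I)"
        using T(2) k \<open>s + k \<le> L\<close> by fastforce
      moreover have "(\<forall>k\<le>n. \<not> G t k) \<or> L \<le> t + n"
        if "s \<le> t" "t < L" "t \<notin> {s..<s + k} \<union> covered T" for t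
        using T(3) that by auto
      ultimately show ?thesis by metis
    next
      case False
      have "L - (s + 1) < L - s" "s + 1 \<le> L" using not_end by auto
      then obtain T where T: "separated T"
        "\<forall>I\<in>T. s + 1 \<le> fst I \<and> snd I \<le> L \<and> G (fst I) (snd I - fst I)"
        "\<forall>t. s + 1 \<le> t \<and> t < L \<and> t \<notin> covered T \<longrightarrow> (\<forall>k\<le>n. \<not> G t k) \<or> L \<le> t + n"
        using less(1) by metis
      have "\<forall>I\<in>T. s \<le> fst I \<and> snd I \<le> L \<and> G (fst I) (snd I - fst I)"
        using T(2) by fastforce
      moreover have "(\<forall>k\<le>n. \<not> G t k) \<or> L \<le> t + n"
        if "s \<le> t" "t < L" "t \<notin> covered T" for t
        using T(3) that False by (cases "t = s") auto
      ultimately show ?thesis using T(1) by metis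
    qed
  qed
qed

lemma window_shift: "window ((shift ^^ t) x) 0 k = window x (of_nat t) k"
  by (simp add: window_def funpow_shift algebra_simps)

lemma good_packing:
  fixes X :: "('i::{linordered_euclidean_semiring,countable} \<Rightarrow> 'a::{finite,discrete_topology}) set"
  assumes X: "closed X" "shift ` X \<subseteq> X"
    and U: "dstar_open X U" "Inr ` ergodic_measures X \<subseteq> U" and \<epsilon>: "\<epsilon> > 0"
  shows "\<exists>L>0. \<forall>x\<in>X. \<exists>T. separated T \<and>
    (\<forall>I\<in>T. snd I \<le> L \<and> m \<le> snd I - fst I \<and> Inl (window x (of_nat (fst I)) (snd I - fst I)) \<in> U) \<and>
    real (card ({..<L} - covered T)) \<le> \<epsilon> * real L"
proof (rule ccontr)
  assume neg: "\<not> ?thesis"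
  interpret algebra X "finitary_sets X" by (rule algebra_finitary_sets)
  define F where "F n = {x\<in>X. \<forall>k. m \<le> k \<and> k \<le> n \<longrightarrow> Inl (window x 0 k) \<notin> U}" for n
  have F: "F n \<in> finitary_sets X" for n
    unfolding F_def by (rule bad_set_finitary)
  \<comment> \<open>This matters for \<open>m = 0\<close>: good blocks have positive length, so the
    greedy scan advances.\<close>
  have nonempty: "Inl [] \<notin> U" using U(1) by (auto simp: dstar_open_def blocks_def window_def)
  \<comment> \<open>One point \<open>x\<close> serves all \<open>n\<close> at once, since it admits
    no sufficient packing at all, in particular none of the greedy ones.\<close>
  have bad_orbit: "\<exists>x\<in>X. \<forall>n. \<epsilon> * real L \<le> visits (F n) L x + real n" if "L > 0" for L
  proof -
    define Q where "Q x T \<longleftrightarrow> separated T \<and>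
      (\<forall>I\<in>T. snd I \<le> L \<and> m \<le> snd I - fst I \<and> Inl (window x (of_nat (fst I)) (snd I - fst I)) \<in> U)" for x :: "'i \<Rightarrow> 'a" and T
    have "\<not> (\<forall>x\<in>X. \<exists>T. Q x T \<and> real (card ({..<L} - covered T)) \<le> \<epsilon> * real L)"
      using neg that unfolding Q_def by blast
    then obtain x where x: "x \<in> X" and noT: "\<And>T. Q x T \<Longrightarrow> \<epsilon> * real L < real (card ({..<L} - covered T))"
      by (auto simp: not_le)
    have "\<epsilon> * real L \<le> visits (F n) L x + real n" for n
    proof -
      define G where "G a k \<longleftrightarrow> m \<le> k \<and> Inl (window x (of_nat a) k) \<in> U" for a k
      have pos: "\<forall>a k. G a k \<longrightarrow> k > 0"
        using nonempty by (auto simp: G_def window_def intro!: gr0I)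
      obtain T where T: "separated T" "\<forall>I\<in>T. snd I \<le> L \<and> G (fst I) (snd I - fst I)"
        "\<And>t. t < L \<Longrightarrow> t \<notin> covered T \<Longrightarrow> (\<forall>k\<le>n. \<not> G t k) \<or> L \<le> t + n"
        using greedy_packing[OF pos, of 0 L n] by auto
      have "{..<L} - covered T \<subseteq> {t\<in>{..<L}. (shift ^^ t) x \<in> F n} \<union> {L - n..<L}"
      proof
        fix t assume t: "t \<in> {..<L} - covered T"
        show "t \<in> {t\<in>{..<L}. (shift ^^ t) x \<in> F n} \<union> {L - n..<L}"
        proof (cases "L \<le> t + n")
          case False
          then have "\<forall>k\<le>n. \<not> G t k" using T(3)[of t] t by auto
          then have "(shift ^^ t) x \<in> F n"
            using funpow_shift_in[OF X(2) x] by (auto simp: F_def G_def window_shift)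
          then show ?thesis using t by auto
        qed (use t in auto)
      qed
      then have "card ({..<L} - covered T) \<le> card ({t\<in>{..<L}. (shift ^^ t) x \<in> F n} \<union> {L - n..<L})"
        by (intro card_mono) auto
      also have "\<dots> \<le> card {t\<in>{..<L}. (shift ^^ t) x \<in> F n} + card {L - n..<L}"
        by (rule card_Un_le)
      also have "\<dots> \<le> card {t\<in>{..<L}. (shift ^^ t) x \<in> F n} + n" by simp
      finally have "real (card ({..<L} - covered T)) \<le> real (card {t\<in>{..<L}. (shift ^^ t) x \<in> F n}) + real n"
        by linarith
      also have "real (card {t\<in>{..<L}. (shift ^^ t) x \<in> F n}) = visits (F n) L x"
        by (simp add: visits_def indicator_def sum.If_cases Int_def)
      finally have "real (card ({..<L} - covered T)) \<le> visits (F n) L x + real n" .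
      moreover have "Q x T" using T(1,2) by (auto simp: Q_def G_def)
      ultimately show ?thesis using noT by fastforce
    qed
    then show ?thesis using x by blast
  qed
  \<comment> \<open>\<open>bad_orbit\<close> for \<open>L = j + 1\<close>, divided by
    \<open>L\<close>. For each fixed \<open>n\<close> the loss \<open>n / (j + 1)\<close> at the end
    of the orbit segment vanishes in the limit.\<close>
  define S where "S j = {\<eta>. \<forall>n\<in>UNIV. \<epsilon> - real n / real (Suc j) \<le> \<eta> (F n)}" for j
  have "\<exists>\<nu>. inv_fa_prob X \<nu> \<and> (\<forall>j. \<nu> \<in> S j)"
  proof (rule inv_fa_prob_limit[of S X 1])
    show "closed (S j \<inter> {\<nu>. \<forall>A. 0 \<le> \<nu> A \<and> \<nu> A \<le> 1})" for j
      unfolding S_def Collect_conj_eq Collect_ball_eq Collect_all_eq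
      by (intro closed_Int closed_INT ballI closed_Collect_le continuous_intros
          continuous_on_product_coordinates)
    show "decseq S"
    proof (rule decseq_SucI, rule subsetI)
      fix j \<eta> assume \<eta>: "\<eta> \<in> S (Suc j)"
      have "real n / real (Suc (Suc j)) \<le> real n / real (Suc j)" for n
        by (intro divide_left_mono) auto
      then have "\<epsilon> - real n / real (Suc j) \<le> \<epsilon> - real n / real (Suc (Suc j))" for n by simp
      moreover have "\<epsilon> - real n / real (Suc (Suc j)) \<le> \<eta> (F n)" for n
        using \<eta> unfolding S_def by blast
      ultimately have "\<epsilon> - real n / real (Suc j) \<le> \<eta> (F n)" for n by (rule order_trans)
      then show "\<eta> \<in> S j" by (simp add: S_def)
    qed
    fix j
    obtain x where x: "x \<in> X" "\<And>n. \<epsilon> * real (Suc j) \<le> visits (F n) (Suc j) x + real n"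
      using bad_orbit[of "Suc j"] by auto
    define \<eta> where "\<eta> A = (if A \<in> finitary_sets X then visits A (Suc j) x / real (Suc j) else 0)" for A
    have v_add: "visits (A \<union> B) (Suc j) x = visits A (Suc j) x + visits B (Suc j) x" if "A \<inter> B = {}" for A B
      unfolding visits_def sum.distrib[symmetric] using that by (intro sum.cong) (auto simp: indicator_def)
    have "visits X (Suc j) x = real (Suc j)"
    proof -
      have "visits X (Suc j) x = (\<Sum>i<Suc j. 1)"
        unfolding visits_def using funpow_shift_in[OF X(2) x(1)] by (intro sum.cong) auto
      then show ?thesis by simp
    qed
    then have "\<eta> X = 1" by (simp add: \<eta>_def)
    moreover have "0 \<le> \<eta> A" for A
      by (simp add: \<eta>_def visits_def sum_nonneg)
    moreover have "\<eta> (A \<union> B) = \<eta> A + \<eta> B"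
      if "A \<in> finitary_sets X" "B \<in> finitary_sets X" "A \<inter> B = {}" for A B
      using that by (simp add: \<eta>_def v_add add_divide_distrib Un)
    moreover have "\<eta> A = 0" if "A \<in> - finitary_sets X" for A
      using that by (simp add: \<eta>_def)
    ultimately have "fa_prob X \<eta>" unfolding fa_prob_def by blast
    moreover have "\<bar>\<eta> (shift -` A \<inter> X) - \<eta> A\<bar> \<le> 1 / real (Suc j)" if A: "A \<in> finitary_sets X" for A
    proof -
      have "visits (shift -` A \<inter> X) (Suc j) x = (\<Sum>i<Suc j. indicator A ((shift ^^ Suc i) x))"
        unfolding visits_def using funpow_shift_in[OF X(2) x(1)] by (intro sum.cong) (auto simp: indicator_def)
      then have "visits (shift -` A \<inter> X) (Suc j) x - visits A (Suc j) x =
          (\<Sum>i<Suc j. indicator A ((shift ^^ Suc i) x) - indicator A ((shift ^^ i) x))"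
        by (simp only: visits_def sum_subtractf)
      also have "\<dots> = indicator A ((shift ^^ Suc j) x) - indicator A ((shift ^^ 0) x)"
        by (rule sum_lessThan_telescope)
      also have "\<bar>\<dots>\<bar> \<le> (1::real)" by (simp add: indicator_def)
      finally have "\<bar>visits (shift -` A \<inter> X) (Suc j) x - visits A (Suc j) x\<bar> / real (Suc j) \<le> 1 / real (Suc j)"
        by (intro divide_right_mono) auto
      then show ?thesis
        using A shift_vimage_finitary[OF X(2) A] by (simp add: \<eta>_def flip: diff_divide_distrib)
    qed
    moreover have "\<epsilon> - real n / real (Suc j) \<le> \<eta> (F n)" for n
    proof -
      have "(\<epsilon> * real (Suc j) - real n) / real (Suc j) \<le> visits (F n) (Suc j) x / real (Suc j)"
        using x(2)[of n] by (intro divide_right_mono) auto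
      then show ?thesis using F[of n] by (simp add: \<eta>_def diff_divide_distrib)
    qed
    ultimately show "\<exists>\<eta>\<in>S j. fa_prob X \<eta> \<and>
      (\<forall>A\<in>finitary_sets X. \<bar>\<eta> (shift -` A \<inter> X) - \<eta> A\<bar> \<le> 1 / real (Suc j))"
      unfolding S_def by blast
  qed
  then obtain \<nu> where \<nu>: "inv_fa_prob X \<nu>" "\<And>j. \<nu> \<in> S j" by blast
  obtain n where n: "\<nu> (F n) < \<epsilon>"
    using bad_measure_small[OF X U \<nu>(1) \<epsilon>] unfolding F_def by blast
  have "\<epsilon> \<le> \<nu> (F n)"
  proof (rule LIMSEQ_le_const2)
    show "(\<lambda>j. \<epsilon> - real n * inverse (real (Suc j))) \<longlonglongrightarrow> \<epsilon>"
      using tendsto_diff[OF tendsto_const tendsto_mult[OF tendsto_const LIMSEQ_inverse_real_of_nat]] by simp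
    have "\<epsilon> - real n * inverse (real (Suc j)) \<le> \<nu> (F n)" for j
      using \<nu>(2)[of j] by (simp add: S_def divide_inverse)
    then show "\<exists>N. \<forall>j\<ge>N. \<epsilon> - real n * inverse (real (Suc j)) \<le> \<nu> (F n)" by blast
  qed
  then show False using n by simp
qed

section \<open>Cutting a point into cells of equal length\<close>

text \<open>The fraction \<open>\<epsilon> / 3\<close> leaves room for doubling when an interval is
  covered by two cells; the fraction \<open>1 / 2\<close>, also imposed, forces every packing to be
  nonempty.\<close>

lemma packings_choice:
  fixes X :: "('i::{linordered_euclidean_semiring,countable} \<Rightarrow> 'a::{finite,discrete_topology}) set"
  assumes X: "closed X" "shift ` X \<subseteq> X"
    and U: "dstar_open X U" "Inr ` ergodic_measures X \<subseteq> U" and \<epsilon>: "\<epsilon> > 0"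
  obtains L T where "L > 0" "\<And>x. x \<in> X \<Longrightarrow> separated (T x)" "\<And>x. x \<in> X \<Longrightarrow> T x \<noteq> {}"
    "\<And>x I. x \<in> X \<Longrightarrow> I \<in> T x \<Longrightarrow> snd I \<le> L \<and> m \<le> snd I - fst I \<and>
      Inl (window x (of_nat (fst I)) (snd I - fst I)) \<in> U"
    "\<And>x. x \<in> X \<Longrightarrow> real (card ({..<L} - covered (T x))) \<le> \<epsilon> / 3 * real L"
proof -
  have "min (\<epsilon> / 3) (1 / 2) > 0" using \<epsilon> by simp
  from good_packing[OF X U this, of m] obtain L where L: "L > 0" and
    "\<forall>x\<in>X. \<exists>T. separated T \<and>
      (\<forall>I\<in>T. snd I \<le> L \<and> m \<le> snd I - fst I \<and> Inl (window x (of_nat (fst I)) (snd I - fst I)) \<in> U) \<and>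
      real (card ({..<L} - covered T)) \<le> min (\<epsilon> / 3) (1 / 2) * real L"
    by blast
  from bchoice[OF this(2)] obtain T where T: "\<forall>x\<in>X. separated (T x) \<and>
      (\<forall>I\<in>T x. snd I \<le> L \<and> m \<le> snd I - fst I \<and> Inl (window x (of_nat (fst I)) (snd I - fst I)) \<in> U) \<and>
      real (card ({..<L} - covered (T x))) \<le> min (\<epsilon> / 3) (1 / 2) * real L"
    by blast
  show thesis
  proof (rule that[OF L, of T])
    fix x assume x: "x \<in> X"
    show "separated (T x)" using T x by blast
    have *: "real (card ({..<L} - covered (T x))) \<le> min (\<epsilon> / 3) (1 / 2) * real L" using T x by blast
    also have "\<dots> \<le> \<epsilon> / 3 * real L" by (intro mult_right_mono) auto
    finally show "real (card ({..<L} - covered (T x))) \<le> \<epsilon> / 3 * real L" .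
    have "min (\<epsilon> / 3) (1 / 2) * real L \<le> 1 / 2 * real L" by (intro mult_right_mono) auto
    then show "T x \<noteq> {}" using * L by (auto simp: covered_def)
    show "snd I \<le> L \<and> m \<le> snd I - fst I \<and> Inl (window x (of_nat (fst I)) (snd I - fst I)) \<in> U"
      if "I \<in> T x" for I
      using T x that by blast
  qed
qed

lemma window_translate: "window (\<lambda>i. x (i + p)) q k = window x (p + q) k"
  by (simp add: window_def ac_simps)

lemma two_sided_translate:
  assumes "two_sided_subshift X" "x \<in> X"
  shows "(\<lambda>i. x (i + p)) \<in> X"
proof -
  have pos: "(\<lambda>i. y (i + int n)) \<in> X" if "y \<in> X" for y n
    using funpow_shift_in[of X y n] that assms(1) by (simp add: two_sided_subshift_def funpow_shift)
  have neg: "(\<lambda>i. y (i - int n)) \<in> X" if "y \<in> X" for y n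
  proof (induction n)
    case 0
    then show ?case using that by simp
  next
    case (Suc n)
    then obtain z where z: "z \<in> X" "(\<lambda>i. y (i - int n)) = shift z"
      using assms(1) unfolding two_sided_subshift_def by blast
    have "y (i - int (Suc n)) = z i" for i
      using fun_cong[OF z(2), of "i - 1"] by (simp add: shift_def algebra_simps)
    then show ?case using z(1) by simp
  qed
  show ?thesis using pos[OF assms(2), of "nat p"] neg[OF assms(2), of "nat (- p)"]
    by (cases "p \<ge> 0") simp_all
qed

lemma cut_points_one_sided:
  fixes T :: "nat \<Rightarrow> (nat \<times> nat) set"
  assumes L: "L > 0" and sep: "\<And>j. separated (T j)" and le: "\<And>j. \<forall>I\<in>T j. snd I \<le> L"
    and ne: "\<And>j. T j \<noteq> {}" and small: "\<And>j. real (card ({..<L} - covered (T j))) \<le> b * real L"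
    and b: "2 * b < \<epsilon>"
  obtains c :: "nat \<Rightarrow> nat" where "cut_points c" "upper_Banach_density (A_coordinates c) < \<epsilon>"
    "\<And>k. k \<in> B_indices \<Longrightarrow> \<exists>j. \<exists>I\<in>T j. c k = j * L + fst I \<and> c (k + 1) = j * L + snd I"
proof -
  obtain c where c: "mono c" "c 0 = 0" "\<And>k. k \<le> c (2 * k)"
    "\<And>k. \<exists>j. \<exists>I\<in>T j. c (2 * k + 1) = j * L + fst I \<and> c (2 * k + 2) = j * L + snd I"
    "\<And>k j t. c (2 * k) \<le> j * L + t \<Longrightarrow> j * L + t < c (2 * k + 1) \<Longrightarrow> t \<notin> covered (T j)"
    by (rule concat_packings[where T = T, OF L sep le ne]) blast
  show thesis
  proof (rule that)
    have "t \<in> (\<Union>k. {c k..<c (k + 1)})" for t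
    proof -
      \<comment> \<open>Some cut point exceeds \<open>t\<close>, and the least such index is
        positive because \<open>c 0 = 0\<close>; the piece just before it contains
        \<open>t\<close>.\<close>
      have ex: "t < c (2 * Suc t)" using c(3)[of "Suc t"] by linarith
      define k where "k = (LEAST k. t < c k)"
      have k: "t < c k" unfolding k_def by (rule LeastI[of "\<lambda>k. t < c k", OF ex])
      then obtain l where l: "k = Suc l" using c(2) by (cases k) auto
      have "\<not> t < c l" unfolding k_def[symmetric] using l not_less_Least[of l "\<lambda>k. t < c k"] k_def by simp
      then show ?thesis using k l by (intro UN_I[of l]) auto
    qed
    then show "cut_points c" using c(1) unfolding cut_points_def by blast
    show "\<exists>j. \<exists>I\<in>T j. c k = j * L + fst I \<and> c (k + 1) = j * L + snd I" if k: "k \<in> B_indices" for k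
    proof -
      have "odd k" using k by (simp add: B_indices_def)
      then obtain l where "k = 2 * l + 1" using oddE by blast
      then show ?thesis using c(4)[of l] by simp
    qed
    define A where "A = A_coordinates c"
    have cell: "real (card (A \<inter> {j * L..<j * L + L})) \<le> b * real L" for j
    proof -
      have "A \<inter> {j * L..<j * L + L} \<subseteq> (\<lambda>t. j * L + t) ` ({..<L} - covered (T j))"
      proof
        fix s assume s: "s \<in> A \<inter> {j * L..<j * L + L}"
        then obtain k where k: "k \<notin> B_indices" "c k \<le> s" "s < c (k + 1)"
          by (auto simp: A_def A_coordinates_def)
        then have "even k" by (simp add: B_indices_def)
        then obtain l where l: "k = 2 * l" by blast
        define t where "t = s - j * L"
        have t: "s = j * L + t" "t < L" using s by (auto simp: t_def)
        then have "t \<notin> covered (T j)" using c(5)[of l j t] k l by simp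
        then show "s \<in> (\<lambda>t. j * L + t) ` ({..<L} - covered (T j))" using t by blast
      qed
      then have "card (A \<inter> {j * L..<j * L + L}) \<le> card ((\<lambda>t. j * L + t) ` ({..<L} - covered (T j)))"
        by (intro card_mono) auto
      also have "\<dots> \<le> card ({..<L} - covered (T j))" by (intro card_image_le) simp
      finally show ?thesis using small[of j] by linarith
    qed
    show "upper_Banach_density (A_coordinates c) < \<epsilon>"
      unfolding A_def[symmetric]
    proof (rule upper_Banach_density_less[OF _ _ L _ b])
      fix i
      define q where "q = i div L"
      have "i = q * L + i mod L" by (simp add: q_def)
      moreover have "i mod L < L" using L by simp
      ultimately have "q * L \<le> i" "i < q * L + L" by linarith+
      then have "A \<inter> {i..<i + of_nat L} \<subseteq> (A \<inter> {q * L..<q * L + L}) \<union> (A \<inter> {Suc q * L..<Suc q * L + L})"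
        by auto
      from two_cells[OF this _ _ cell cell]
      show "real (card (A \<inter> {i..<i + of_nat L})) \<le> 2 * b * real L" by simp
    qed auto
  qed
qed

text \<open>The origin is a cell boundary, so no block crosses it and the half-lines can be
  enumerated independently, each outwards from \<open>0\<close> and starting with a gap. This
  produces the adjacent pieces \<open>A\<^sub>-\<^sub>1\<close> and
  \<open>A\<^sub>1\<close>.\<close>

lemma cut_points_two_sided:
  fixes T :: "int \<Rightarrow> (nat \<times> nat) set"
  assumes L: "L > 0" and sep: "\<And>j. separated (T j)" and le: "\<And>j. \<forall>I\<in>T j. snd I \<le> L"
    and ne: "\<And>j. T j \<noteq> {}" and small: "\<And>j. real (card ({..<L} - covered (T j))) \<le> b * real L"
    and b: "2 * b < \<epsilon>"
  obtains c :: "int \<Rightarrow> int" where "cut_points c" "upper_Banach_density (A_coordinates c) < \<epsilon>"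
    "\<And>k. k \<in> B_indices \<Longrightarrow>
      \<exists>j. \<exists>I\<in>T j. c k = j * int L + int (fst I) \<and> c (k + 1) = j * int L + int (snd I)"
proof -
  \<comment> \<open>the negative half-line is reflected by \<open>t \<mapsto> - 1 - t\<close>\<close>
  define T' where "T' j = (\<lambda>I. (L - snd I, L - fst I)) ` T (- int j - 1)" for j
  have lt: "fst I < snd I" if "I \<in> T j" for I j using sep[of j] that by (simp add: separated_def)
  have sep': "separated (T' j)" for j
    unfolding separated_def
  proof (intro conjI ballI)
    fix I assume "I \<in> T' j"
    then obtain I' where "I' \<in> T (- int j - 1)" "I = (L - snd I', L - fst I')" by (auto simp: T'_def)
    then show "fst I < snd I" using lt[of I'] bspec[OF le, of I'] by fastforce
  next
    fix I J assume "I \<in> T' j" "J \<in> T' j"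
    then obtain I' J' where IJ: "I' \<in> T (- int j - 1)" "I = (L - snd I', L - fst I')"
      "J' \<in> T (- int j - 1)" "J = (L - snd J', L - fst J')"
      by (auto simp: T'_def)
    have "I' = J' \<or> snd I' \<le> fst J' \<or> snd J' \<le> fst I'"
      using sep IJ(1,3) unfolding separated_def by blast
    then show "I = J \<or> snd I \<le> fst J \<or> snd J \<le> fst I" using IJ(2,4) by auto
  qed
  obtain r where r: "mono r" "r 0 = 0" "\<And>k. k \<le> r (2 * k)"
    "\<And>k. \<exists>j. \<exists>I\<in>T (int j). r (2 * k + 1) = j * L + fst I \<and> r (2 * k + 2) = j * L + snd I"
    "\<And>k j t. r (2 * k) \<le> j * L + t \<Longrightarrow> j * L + t < r (2 * k + 1) \<Longrightarrow> t \<notin> covered (T (int j))"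
    by (rule concat_packings[where T = "\<lambda>j. T (int j)", OF L sep le ne]) blast
  obtain l where l: "mono l" "l 0 = 0" "\<And>k. k \<le> l (2 * k)"
    "\<And>k. \<exists>j. \<exists>I\<in>T' j. l (2 * k + 1) = j * L + fst I \<and> l (2 * k + 2) = j * L + snd I"
    "\<And>k j t. l (2 * k) \<le> j * L + t \<Longrightarrow> j * L + t < l (2 * k + 1) \<Longrightarrow> t \<notin> covered (T' j)"
  proof (rule concat_packings[where T = T', OF L sep'])
    show "\<forall>I\<in>T' j. snd I \<le> L" for j by (auto simp: T'_def)
    show "T' j \<noteq> {}" for j using ne by (simp add: T'_def)
  qed blast
  define c where "c k = (if 0 \<le> k then int (r (nat k)) else - int (l (nat (- k))))" for k
  have c_pos: "c (int k) = int (r k)" and c_neg: "c (- int k) = - int (l k)" for k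
    using r(2) l(2) by (auto simp: c_def)
  have mono: "mono c"
  proof (rule monoI)
    fix i j :: int assume "i \<le> j"
    then show "c i \<le> c j"
      using monoD[OF r(1), of "nat i" "nat j"] monoD[OF l(1), of "nat (- j)" "nat (- i)"]
      by (auto simp: c_def)
  qed
  show thesis
  proof (rule that)
    have "t \<in> (\<Union>k. {c k..<c (k + 1)})" for t
    proof -
      \<comment> \<open>The outer bounds come from the growth of \<open>r\<close> and
        \<open>l\<close>: the cut point at the lower index is at most \<open>t\<close>, the one at
        the upper index exceeds \<open>t\<close>. The largest index in \<open>K\<close> is that of
        the piece containing \<open>t\<close>.\<close>
      define K where "K = {k \<in> {- 2 * int (nat (- t))..2 * int (nat (t + 1))}. c k \<le> t}"
      have "c (- 2 * int (nat (- t))) \<le> t"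
        using c_neg[of "2 * nat (- t)"] l(3)[of "nat (- t)"] by simp
      then have "- 2 * int (nat (- t)) \<in> K" by (simp add: K_def)
      moreover have "finite K"
        unfolding K_def by (rule finite_subset[OF Collect_restrict]) (rule finite_atLeastAtMost_int)
      ultimately have K: "Max K \<in> K" "\<And>k. k \<in> K \<Longrightarrow> k \<le> Max K"
        using Max_in Max_ge by blast+
      have top: "t < c (2 * int (nat (t + 1)))"
        using c_pos[of "2 * nat (t + 1)"] r(3)[of "nat (t + 1)"] by simp
      have "\<not> c (Max K + 1) \<le> t"
      proof
        assume "c (Max K + 1) \<le> t"
        then have "Max K + 1 \<notin> K \<Longrightarrow> 2 * int (nat (t + 1)) \<le> Max K"
          using K(1) by (auto simp: K_def)
        moreover have "Max K + 1 \<notin> K" using K(2)[of "Max K + 1"] by auto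
        ultimately have "c (2 * int (nat (t + 1))) \<le> c (Max K)" using monoD[OF mono] by blast
        then show False using K(1) top by (simp add: K_def)
      qed
      then show ?thesis using K(1) by (intro UN_I[of "Max K"]) (auto simp: K_def)
    qed
    then show "cut_points c" using mono unfolding cut_points_def by blast
    show "\<exists>j. \<exists>I\<in>T j. c k = j * int L + int (fst I) \<and> c (k + 1) = j * int L + int (snd I)"
      if k: "k \<in> B_indices" for k
    proof (cases "0 \<le> k")
      case True
      then have "odd (nat k)" using k by (simp add: B_indices_def even_nat_iff)
      then obtain n where n: "nat k = 2 * n + 1" using oddE by blast
      obtain j I where "I \<in> T (int j)" "r (2 * n + 1) = j * L + fst I" "r (2 * n + 2) = j * L + snd I"
        using r(4) by blast
      moreover have "k = int (2 * n + 1)" "k + 1 = int (2 * n + 2)" using n True by auto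
      then have "c k = int (r (2 * n + 1))" "c (k + 1) = int (r (2 * n + 2))" by (simp_all only: c_pos)
      ultimately show ?thesis by (intro exI[of _ "int j"] bexI[of _ I]) simp_all
    next
      case False
      then have "even (nat (- k))" using k by (simp add: B_indices_def even_nat_iff)
      then obtain n' where n': "nat (- k) = 2 * n'" by blast
      then obtain n where "n' = Suc n" using False by (cases n') auto
      then have n: "nat (- k) = 2 * n + 2" using n' by simp
      \<comment> \<open>Reflection reverses the ends: piece \<open>- (2 * n + 2)\<close> runs from
        \<open>- l (2 * n + 2)\<close> to \<open>- l (2 * n + 1)\<close>, so it comes from an
        interval chosen on the reflected half-line.\<close>
      obtain j J where "J \<in> T' j" "l (2 * n + 1) = j * L + fst J" "l (2 * n + 2) = j * L + snd J"
        using l(4) by blast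
      then obtain I where I: "I \<in> T (- int j - 1)" "l (2 * n + 1) = j * L + (L - snd I)"
        "l (2 * n + 2) = j * L + (L - fst I)"
        by (auto simp: T'_def)
      have IL: "snd I \<le> L" "fst I \<le> L" using bspec[OF le I(1)] lt[OF I(1)] by auto
      have "k = - int (2 * n + 2)" "k + 1 = - int (2 * n + 1)" using n False by auto
      then have "c k = - int (l (2 * n + 2))" "c (k + 1) = - int (l (2 * n + 1))" by (simp_all only: c_neg)
      then show ?thesis
        using IL unfolding I(2,3)
        by (intro exI[of _ "- int j - 1"] bexI[OF _ I(1)]) (simp add: of_nat_diff algebra_simps)
    qed
    define A where "A = A_coordinates c"
    have cell: "real (card (A \<inter> {j * int L..<j * int L + int L})) \<le> b * real L" for j
    proof -
      have "A \<inter> {j * int L..<j * int L + int L} \<subseteq> (\<lambda>t. j * int L + int t) ` ({..<L} - covered (T j))"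
      proof
        fix s assume s: "s \<in> A \<inter> {j * int L..<j * int L + int L}"
        then obtain k where k: "k \<notin> B_indices" "c k \<le> s" "s < c (k + 1)"
          by (auto simp: A_def A_coordinates_def)
        define t where "t = nat (s - j * int L)"
        have t: "s = j * int L + int t" "t < L" using s by (auto simp: t_def)
        have "t \<notin> covered (T j)"
        proof (cases "0 \<le> k")
          case True
          then have "even (nat k)" using k(1) by (simp add: B_indices_def even_nat_iff)
          then obtain n where n: "nat k = 2 * n" by blast
          have "k = int (2 * n)" "k + 1 = int (2 * n + 1)" using n True by auto
          then have rs: "int (r (2 * n)) \<le> s" "s < int (r (2 * n + 1))" using k(2,3) by (simp_all only: c_pos)
          have "j \<ge> 0"
          proof (rule ccontr)
            assume "\<not> j \<ge> 0"
            then have "(j + 1) * int L \<le> 0" by (simp add: mult_nonpos_nonneg)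
            then show False using t rs(1) by (simp add: algebra_simps)
          qed
          then have s': "s = int (nat j * L + t)" using t(1) by simp
          have "r (2 * n) \<le> nat j * L + t" "nat j * L + t < r (2 * n + 1)"
            using rs by (simp_all only: s' of_nat_le_iff of_nat_less_iff)
          from r(5)[OF this] show ?thesis using \<open>j \<ge> 0\<close> by simp
        next
          case False
          then have "odd (nat (- k))" using k(1) by (simp add: B_indices_def even_nat_iff)
          then obtain n where n: "nat (- k) = 2 * n + 1" using oddE by blast
          have "k = - int (2 * n + 1)" "k + 1 = - int (2 * n)" using n False by auto
          then have ls: "- int (l (2 * n + 1)) \<le> s" "s < - int (l (2 * n))" using k(2,3) by (simp_all only: c_neg)
          have "j < 0"
          proof (rule ccontr)
            assume "\<not> j < 0"
            then have "0 \<le> j * int L" by simp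
            then show False using t ls(2) by simp
          qed
          define i where "i = nat (- j - 1)"
          have j: "j = - int i - 1" using \<open>j < 0\<close> by (simp add: i_def)
          \<comment> \<open>The reflection sends coordinate \<open>s\<close> to
            \<open>- 1 - s\<close>, cell \<open>- i - 1\<close> to cell \<open>i\<close>, and offset
            \<open>t\<close> to \<open>L - 1 - t\<close>.\<close>
          have "int (i * L + (L - 1 - t)) = - 1 - s"
            using t(2) unfolding t(1) j by (simp add: of_nat_diff algebra_simps)
          then have "L - 1 - t \<notin> covered (T' i)" using l(5)[of n i "L - 1 - t"] ls by linarith
          moreover have "L - 1 - t \<in> covered (T' i)" if tc: "t \<in> covered (T j)"
          proof -
            obtain I where I: "I \<in> T j" "fst I \<le> t" "t < snd I" using tc by (auto simp: covered_def)
            then have "(L - snd I, L - fst I) \<in> T' i" by (auto simp: T'_def j)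
            moreover have "L - 1 - t \<in> {L - snd I..<L - fst I}" using I(2,3) bspec[OF le I(1)] t(2) by auto
            ultimately show ?thesis unfolding covered_def by force
          qed
          ultimately show ?thesis by blast
        qed
        then show "s \<in> (\<lambda>t. j * int L + int t) ` ({..<L} - covered (T j))" using t by blast
      qed
      then have "card (A \<inter> {j * int L..<j * int L + int L}) \<le> card ((\<lambda>t. j * int L + int t) ` ({..<L} - covered (T j)))"
        by (intro card_mono) auto
      also have "\<dots> \<le> card ({..<L} - covered (T j))" by (intro card_image_le) simp
      finally show ?thesis using small[of j] by linarith
    qed
    show "upper_Banach_density (A_coordinates c) < \<epsilon>"
      unfolding A_def[symmetric]
    proof (rule upper_Banach_density_less[OF _ _ L _ b])
      fix i
      define q where "q = i div int L"
      have "i = q * int L + i mod int L" by (simp add: q_def)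
      moreover have "0 \<le> i mod int L" "i mod int L < int L" using L by auto
      moreover have "(q + 1) * int L = q * int L + int L" by (simp add: algebra_simps)
      ultimately have "q * int L \<le> i" "i < q * int L + int L" "(q + 1) * int L = q * int L + int L"
        by linarith+
      then have "A \<inter> {i..<i + of_nat L} \<subseteq>
          (A \<inter> {q * int L..<q * int L + int L}) \<union> (A \<inter> {(q + 1) * int L..<(q + 1) * int L + int L})"
        by auto
      from two_cells[OF this _ _ cell cell]
      show "real (card (A \<inter> {i..<i + of_nat L})) \<le> 2 * b * real L" by simp
    qed auto
  qed
qed

theorem theorem2p4:
  shows "(\<forall>(X :: (int \<Rightarrow> 'a::{finite,discrete_topology}) set) U.
           two_sided_subshift X \<longrightarrow> dstar_open X U \<longrightarrow> Inr ` ergodic_measures X \<subseteq> U \<longrightarrow>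
           (\<forall>m::nat. \<forall>\<epsilon>::real. \<epsilon> > 0 \<longrightarrow>
             (\<exists>n\<ge>m. \<forall>x\<in>X. \<exists>c. cut_points c \<and>
               (\<forall>k\<in>B_indices. Inl (piece x c k) \<in> U \<and>
                  m \<le> length (piece x c k) \<and> length (piece x c k) \<le> n) \<and>
               upper_Banach_density (A_coordinates c) < \<epsilon>))) \<and>
         (\<forall>(X :: (nat \<Rightarrow> 'a::{finite,discrete_topology}) set) U.
           one_sided_subshift X \<longrightarrow> dstar_open X U \<longrightarrow> Inr ` ergodic_measures X \<subseteq> U \<longrightarrow>
           (\<forall>m::nat. \<forall>\<epsilon>::real. \<epsilon> > 0 \<longrightarrow>
             (\<exists>n\<ge>m. \<forall>x\<in>X. \<exists>c. cut_points c \<and>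
               (\<forall>k\<in>B_indices. Inl (piece x c k) \<in> U \<and>
                  m \<le> length (piece x c k) \<and> length (piece x c k) \<le> n) \<and>
               upper_Banach_density (A_coordinates c) < \<epsilon>)))"
proof (intro conjI allI impI)
  fix X :: "(int \<Rightarrow> 'a) set" and U and m :: nat and \<epsilon> :: real
  assume X: "two_sided_subshift X" and U: "dstar_open X U" "Inr ` ergodic_measures X \<subseteq> U" and \<epsilon>: "\<epsilon> > 0"
  have X': "closed X" "shift ` X \<subseteq> X" using X by (auto simp: two_sided_subshift_def)
  obtain L T where L: "L > 0" and T: "\<And>x. x \<in> X \<Longrightarrow> separated (T x)" "\<And>x. x \<in> X \<Longrightarrow> T x \<noteq> {}"
    "\<And>x I. x \<in> X \<Longrightarrow> I \<in> T x \<Longrightarrow> snd I \<le> L \<and> m \<le> snd I - fst I \<and>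
      Inl (window x (of_nat (fst I)) (snd I - fst I)) \<in> U"
    "\<And>x. x \<in> X \<Longrightarrow> real (card ({..<L} - covered (T x))) \<le> \<epsilon> / 3 * real L"
    by (rule packings_choice[OF X' U \<epsilon>, of m]) blast
  show "\<exists>n\<ge>m. \<forall>x\<in>X. \<exists>c. cut_points c \<and>
               (\<forall>k\<in>B_indices. Inl (piece x c k) \<in> U \<and>
                  m \<le> length (piece x c k) \<and> length (piece x c k) \<le> n) \<and>
               upper_Banach_density (A_coordinates c) < \<epsilon>"
  \<comment> \<open>Each block lies in a single cell, so \<open>L\<close> bounds its length; the
    maximum gives \<open>n \<ge> m\<close> also when \<open>X\<close> is empty.\<close>
  proof (intro exI[of _ "max m L"] conjI ballI)
    fix x assume x: "x \<in> X"
    \<comment> \<open>Cell \<open>j\<close> of \<open>x\<close> is the initial cell of the translate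
      \<open>y j\<close>, which lies in \<open>X\<close> and so has a packing.\<close>
    define y where "y j = (\<lambda>i. x (i + j * int L))" for j
    have y: "y j \<in> X" for j unfolding y_def by (rule two_sided_translate[OF X x])
    obtain c where c: "cut_points c" "upper_Banach_density (A_coordinates c) < \<epsilon>"
      "\<And>k. k \<in> B_indices \<Longrightarrow>
        \<exists>j. \<exists>I\<in>T (y j). c k = j * int L + int (fst I) \<and> c (k + 1) = j * int L + int (snd I)"
    proof (rule cut_points_two_sided[where T = "\<lambda>j. T (y j)" and \<epsilon> = \<epsilon>, OF L T(1)[OF y] _ T(2)[OF y] T(4)[OF y]])
      show "\<forall>I\<in>T (y j). snd I \<le> L" for j using T(3)[OF y] by blast
    qed (use \<epsilon> in auto)
    have "Inl (piece x c k) \<in> U \<and> m \<le> length (piece x c k) \<and> length (piece x c k) \<le> max m L"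
      if k: "k \<in> B_indices" for k
    proof -
      obtain j I where I: "I \<in> T (y j)" "c k = j * int L + int (fst I)" "c (k + 1) = j * int L + int (snd I)"
        using c(3)[OF k] by blast
      have "piece x c k = window (y j) (of_nat (fst I)) (snd I - fst I)"
        by (simp add: piece_def I(2,3) y_def window_translate nat_diff_distrib')
      then show ?thesis using T(3)[OF y I(1)] by auto
    qed
    then show "\<exists>c. cut_points c \<and>
               (\<forall>k\<in>B_indices. Inl (piece x c k) \<in> U \<and>
                  m \<le> length (piece x c k) \<and> length (piece x c k) \<le> max m L) \<and>
               upper_Banach_density (A_coordinates c) < \<epsilon>"
      using c(1,2) by blast
  qed simp
next
  fix X :: "(nat \<Rightarrow> 'a) set" and U and m :: nat and \<epsilon> :: real
  assume X: "one_sided_subshift X" and U: "dstar_open X U" "Inr ` ergodic_measures X \<subseteq> U" and \<epsilon>: "\<epsilon> > 0"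
  have X': "closed X" "shift ` X \<subseteq> X" using X by (auto simp: one_sided_subshift_def)
  obtain L T where L: "L > 0" and T: "\<And>x. x \<in> X \<Longrightarrow> separated (T x)" "\<And>x. x \<in> X \<Longrightarrow> T x \<noteq> {}"
    "\<And>x I. x \<in> X \<Longrightarrow> I \<in> T x \<Longrightarrow> snd I \<le> L \<and> m \<le> snd I - fst I \<and>
      Inl (window x (of_nat (fst I)) (snd I - fst I)) \<in> U"
    "\<And>x. x \<in> X \<Longrightarrow> real (card ({..<L} - covered (T x))) \<le> \<epsilon> / 3 * real L"
    by (rule packings_choice[OF X' U \<epsilon>, of m]) blast
  show "\<exists>n\<ge>m. \<forall>x\<in>X. \<exists>c. cut_points c \<and>
               (\<forall>k\<in>B_indices. Inl (piece x c k) \<in> U \<and>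
                  m \<le> length (piece x c k) \<and> length (piece x c k) \<le> n) \<and>
               upper_Banach_density (A_coordinates c) < \<epsilon>"
  proof (intro exI[of _ "max m L"] conjI ballI)
    fix x assume x: "x \<in> X"
    define y where "y j = (\<lambda>i. x (i + j * L))" for j
    have y: "y j \<in> X" for j
      using funpow_shift_in[OF X'(2) x, of "j * L"] by (simp add: y_def funpow_shift)
    obtain c where c: "cut_points c" "upper_Banach_density (A_coordinates c) < \<epsilon>"
      "\<And>k. k \<in> B_indices \<Longrightarrow> \<exists>j. \<exists>I\<in>T (y j). c k = j * L + fst I \<and> c (k + 1) = j * L + snd I"
    proof (rule cut_points_one_sided[where T = "\<lambda>j. T (y j)" and \<epsilon> = \<epsilon>, OF L T(1)[OF y] _ T(2)[OF y] T(4)[OF y]])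
      show "\<forall>I\<in>T (y j). snd I \<le> L" for j using T(3)[OF y] by blast
    qed (use \<epsilon> in auto)
    have "Inl (piece x c k) \<in> U \<and> m \<le> length (piece x c k) \<and> length (piece x c k) \<le> max m L"
      if k: "k \<in> B_indices" for k
    proof -
      obtain j I where I: "I \<in> T (y j)" "c k = j * L + fst I" "c (k + 1) = j * L + snd I"
        using c(3)[OF k] by blast
      have "piece x c k = window (y j) (of_nat (fst I)) (snd I - fst I)"
        by (simp add: piece_def I(2,3)[simplified] y_def window_translate)
      then show ?thesis using T(3)[OF y I(1)] by auto
    qed
    then show "\<exists>c. cut_points c \<and>
               (\<forall>k\<in>B_indices. Inl (piece x c k) \<in> U \<and>
                  m \<le> length (piece x c k) \<and> length (piece x c k) \<le> max m L) \<and>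
               upper_Banach_density (A_coordinates c) < \<epsilon>"
      using c(1,2) by blast
  qed simp
qed

end
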